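(* Let $\lambda>0$ be fixed and set $q=q_N=e^{-\lambda/N}$. Then for every positive integer $p$, as $N\to\infty$, $$q^p\,m_{N,2p}=\big(q(1-q)\big)^p\,\widehat m_{N,2p}=\mathcal M_{2p,0}\,N+\frac{\mathcal M_{2p,1}}{N}+O\!\left(\frac1{N^3}\right),$$ where $$\mathcal M_{2p,0}=\frac{1}{\lambda p}\,I_{1-e^{-\lambda}}(p+1,p),$$ $$\mathcal M_{2p,1}=-\frac{\lambda p}{6}\left(I_{1-e^{-\lambda}}(p+1,p)+\frac{(2p-1)!}{p!\,(p-1)!}\,e^{-p\lambda}(1-e^{-\lambda})^{p-1}\Big(2+p-(2p+1)e^{-\lambda}\Big)\right).$$
   Context: Regularised incomplete beta function: $I_x(a,b)=\frac{\Gamma(a+b)}{\Gamma(a)\Gamma(b)}\int_0^xt^{a-1}(1-t)^{b-1}\,dt$. For $0<q<1$: $(a;q)_n=\prod_{i=0}^{n-1}(1-aq^i)$, $(a_1,\dots,a_k;q)_\infty=\prod_{i\ge0}(1-a_1q^i)\cdots(1-a_kq^i)$. Jackson integral: for $\alpha>0$, $\int_{-\alpha}^{\alpha}f(x)\,d_qx=(1-q)\sum_{k=0}^\infty \alpha q^k\big(f(\alpha q^k)+f(-\alpha q^k)\big)$. Discrete $q$-Hermite weight: $\omega(x)=\frac{(qx,-qx;q)_\infty}{(q,-1,-q;q)_\infty}$ on the points $\pm q^k$, $k=0,1,2,\dots$. Discrete $q$-Hermite polynomials: monic polynomials with $H_0=1$, $H_1=x$, $xH_n(x;q)=H_{n+1}(x;q)+q^{n-1}(1-q^n)H_{n-1}(x;q)$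 for $n\ge1$, satisfying $\int_{-1}^1H_mH_n\,\omega\,d_qx=(1-q)(q;q)_nq^{n(n-1)/2}\delta_{mn}$. Density of the discrete $q$-deformed GUE: $\rho_N(x)=\frac1{1-q}\sum_{j=0}^{N-1}\frac{H_j(x;q)^2}{(q;q)_j\,q^{j(j-1)/2}}\,\omega(x)$. Spectral moments: $m_{N,2p}=\int_{-1}^1|x|^{2p}\rho_N(x)\,d_qx$ and $\widehat m_{N,2p}=(1-q)^{-p}m_{N,2p}$. *)

theory Defs
  imports
    "HOL-Analysis.Analysis"
    "HOL-Library.Landau_Symbols"
    "HOL-Computational_Algebra.Polynomial"
begin

definition reg_inc_beta :: "real \<Rightarrow> real \<Rightarrow> real \<Rightarrow> real" where
  "reg_inc_beta x a b =
     Gamma (a + b) / (Gamma a * Gamma b) *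
     integral {0..x} (\<lambda>t. t powr (a - 1) * (1 - t) powr (b - 1))"

text \<open>The finite and infinite $q$-Pochhammer symbols \<open>(a;q)\<^sub>n\<close> and
  \<open>(a\<^sub>1,\<dots>,a\<^sub>k;q)\<^sub>\<infinity>\<close>; the latter takes the list of its parameters.\<close>

definition qpoch :: "real \<Rightarrow> real \<Rightarrow> nat \<Rightarrow> real" where
  "qpoch a q n = (\<Prod>i<n. 1 - a * q ^ i)"

definition qpoch_inf :: "real list \<Rightarrow> real \<Rightarrow> real" where
  "qpoch_inf as q = (\<Prod>i. \<Prod>a\<leftarrow>as. 1 - a * q ^ i)"

text \<open>The Jackson integral over the symmetric interval from \<open>-\<alpha>\<close> to \<open>\<alpha>\<close>.\<close>

definition jackson_integral :: "real \<Rightarrow> real \<Rightarrow> (real \<Rightarrow> real) \<Rightarrow> real" where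
  "jackson_integral q \<alpha> f =
     (1 - q) * (\<Sum>k. \<alpha> * q ^ k * (f (\<alpha> * q ^ k) + f (- (\<alpha> * q ^ k))))"

definition qherm_weight :: "real \<Rightarrow> real \<Rightarrow> real" where
  "qherm_weight q x = qpoch_inf [q * x, - (q * x)] q / qpoch_inf [q, - 1, - q] q"

text \<open>The last equation is \<open>x H\<^sub>m = H\<^sub>m\<^sub>+\<^sub>1 + q\<^sup>m\<^sup>-\<^sup>1 (1 - q\<^sup>m) H\<^sub>m\<^sub>-\<^sub>1\<close> with \<open>m = n + 1\<close>.\<close>

fun qherm :: "real \<Rightarrow> nat \<Rightarrow> real poly" where
  "qherm q 0 = 1"
| "qherm q (Suc 0) = [:0, 1:]"
| "qherm q (Suc (Suc n)) =
     [:0, 1:] * qherm q (Suc n) - smult (q ^ n * (1 - q ^ Suc n)) (qherm q n)"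

definition qGUE_density :: "real \<Rightarrow> nat \<Rightarrow> real \<Rightarrow> real" where
  "qGUE_density q N x =
     1 / (1 - q) *
     (\<Sum>j<N. (poly (qherm q j) x)\<^sup>2 / (qpoch q q j * q ^ (j * (j - 1) div 2))) *
     qherm_weight q x"

text \<open>The spectral moments \<open>m\<^sub>N\<^sub>,\<^sub>2\<^sub>p\<close> and their rescaled versions, indexed by \<open>p\<close>.\<close>

definition qGUE_moment :: "real \<Rightarrow> nat \<Rightarrow> nat \<Rightarrow> real" where
  "qGUE_moment q N p = jackson_integral q 1 (\<lambda>x. \<bar>x\<bar> ^ (2 * p) * qGUE_density q N x)"

definition qGUE_moment_hat :: "real \<Rightarrow> nat \<Rightarrow> nat \<Rightarrow> real" where
  "qGUE_moment_hat q N p = qGUE_moment q N p / (1 - q) ^ p"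

definition q_scaled :: "real \<Rightarrow> nat \<Rightarrow> real" where
  "q_scaled lam N = exp (- lam / real N)"

text \<open>The expansion coefficients \<open>\<M>\<^sub>2\<^sub>p\<^sub>,\<^sub>0\<close> and \<open>\<M>\<^sub>2\<^sub>p\<^sub>,\<^sub>1\<close>, meant for \<open>p \<ge> 1\<close>
  (the natural-number subtractions below truncate at \<open>p = 0\<close>).\<close>

definition M_coeff0 :: "real \<Rightarrow> nat \<Rightarrow> real" where
  "M_coeff0 lam p =
     1 / (lam * real p) * reg_inc_beta (1 - exp (- lam)) (real p + 1) (real p)"

definition M_coeff1 :: "real \<Rightarrow> nat \<Rightarrow> real" where
  "M_coeff1 lam p =
     - (lam * real p / 6) *
     (reg_inc_beta (1 - exp (- lam)) (real p + 1) (real p) +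
      fact (2 * p - 1) / (fact p * fact (p - 1)) *
      exp (- (real p * lam)) * (1 - exp (- lam)) ^ (p - 1) *
      (2 + real p - (2 * real p + 1) * exp (- lam)))"

end

theory Submission
  imports Defs "HOL-Real_Asymp.Real_Asymp"
begin

text \<open>By orthogonality, \<open>q\<^sup>p m\<^sub>N\<^sub>,\<^sub>2\<^sub>p\<close> is the sum over \<open>j < N\<close> of the total weight of the
  lattice bridges with \<open>2p\<close> steps, where a down-step from height \<open>s\<close> to \<open>s - 1\<close> has weight \<open>f(q\<^sup>j\<^sup>+\<^sup>s)\<close>,
  \<open>f(t) = t (1 - t)\<close>. With \<open>q = exp(-h)\<close>, \<open>h = \<lambda>/N\<close> and the midpoint variable \<open>z = exp(-(j + 1/2) h)\<close>,
  this weight is \<open>f(z exp(-(s - 1/2) h))\<close>, and reflecting the bridges shows that their total weight is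
  even in \<open>h\<close>, so that it equals \<open>Q\<^sub>0(z) + h\<^sup>2 Q\<^sub>2(z) + O(h\<^sup>4)\<close> with explicit polynomials \<open>Q\<^sub>0\<close>, \<open>Q\<^sub>2\<close>. The midpoint
  rule turns the sum over \<open>j\<close> into integrals, and both \<open>Q\<^sub>0(z)/z\<close> and \<open>Q\<^sub>2(z)/z\<close> can be integrated in
  terms of the incomplete beta function.\<close>

section \<open>The discrete $q$-Hermite weight\<close>

lemma convergent_prod_geometric:
  fixes q c :: real
  assumes "0 < q" "q < 1"
  shows "convergent_prod (\<lambda>i. 1 + c * q ^ i)"
proof (rule abs_convergent_prod_imp_convergent_prod)
  have "summable (\<lambda>i. \<bar>c\<bar> * q ^ i)"
    using assms by (intro summable_mult summable_geometric) auto
  then show "abs_convergent_prod (\<lambda>i. 1 + c * q ^ i)"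
    using assms by (simp add: abs_convergent_prod_conv_summable abs_mult)
qed

text \<open>This is \<open>(q^(2k+2); q^2)_\<infinity>\<close>, the numerator of the weight at both
  points \<open>q^k\<close> and \<open>-q^k\<close>: pairing the factors of opposite sign gives a
  product in \<open>q^2\<close>.\<close>

definition weight_tail :: "real \<Rightarrow> nat \<Rightarrow> real" where
  "weight_tail q k = (\<Prod>i. 1 - q ^ (2 * Suc (k + i)))"

lemma convergent_prod_weight_tail:
  assumes "0 < q" "q < 1"
  shows "convergent_prod (\<lambda>i. 1 - (q::real) ^ (2 * Suc (k + i)))"
proof -
  have "q ^ (2 * Suc (k + i)) = q ^ (2 * Suc k) * (q\<^sup>2) ^ i" for i
    unfolding power_mult [symmetric] power_add [symmetric]
    by (rule arg_cong[of _ _ "power q"]) simp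
  then show ?thesis
    using convergent_prod_geometric[of "q\<^sup>2" "- (q ^ (2 * Suc k))"] assms
    by (simp add: power_less_one_iff del: mult_Suc_right power_Suc)
qed

lemma weight_tail_Suc:
  assumes "0 < q" "q < 1"
  shows "weight_tail q k = (1 - q ^ (2 * Suc k)) * weight_tail q (Suc k)"
proof -
  have "q ^ (2 * Suc k) < 1"
    using assms power_Suc_less_one[of q "2 * k + 1"] by simp
  then show ?thesis
    using prodinf_split_head[OF convergent_prod_weight_tail[OF assms, of k]]
    by (simp add: weight_tail_def field_simps del: power_Suc)
qed

lemma weight_tail_nonneg_le_one:
  assumes "0 < q" "q < 1"
  shows "0 \<le> weight_tail q k" "weight_tail q k \<le> 1"
proof -
  have lim: "(\<lambda>n. \<Prod>i\<le>n. 1 - q ^ (2 * Suc (k + i))) \<longlonglongrightarrow> weight_tail q k"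
    unfolding weight_tail_def
    by (rule convergent_prod_LIMSEQ[OF convergent_prod_weight_tail[OF assms]])
  have "q ^ m \<le> 1" for m
    using assms by (intro power_le_one) auto
  then have "0 \<le> (\<Prod>i\<le>n. 1 - q ^ (2 * Suc (k + i)))"
      "(\<Prod>i\<le>n. 1 - q ^ (2 * Suc (k + i))) \<le> 1" for n
    using assms by (auto intro!: prod_nonneg prod_le_1 simp del: mult_Suc_right)
  then show "0 \<le> weight_tail q k" "weight_tail q k \<le> 1"
    using LIMSEQ_le_const[OF lim] LIMSEQ_le_const2[OF lim] by blast+
qed

lemma qherm_weight_at_points:
  assumes "0 < q" "q < 1" "x = q ^ k \<or> x = - (q ^ k)"
  shows "qherm_weight q x = weight_tail q k / qpoch_inf [q, - 1, - q] q"
proof -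
  have "(\<Prod>a\<leftarrow>[q * x, - (q * x)]. 1 - a * q ^ i) = 1 - q ^ (2 * Suc (k + i))" for i
  proof -
    have "(\<Prod>a\<leftarrow>[q * x, - (q * x)]. 1 - a * q ^ i) = 1 - x\<^sup>2 * (q * q ^ i)\<^sup>2"
      by (simp add: algebra_simps power2_eq_square)
    also have "(q * q ^ i)\<^sup>2 = q ^ (2 * Suc i)"
      by (simp add: power_mult_distrib power_add power2_eq_square power_even_eq)
    also have "x\<^sup>2 = (q ^ k)\<^sup>2"
      using assms(3) by auto
    finally show ?thesis
      by (simp add: power_even_eq [symmetric] power_add [symmetric] algebra_simps)
  qed
  then show ?thesis
    by (simp add: qherm_weight_def qpoch_inf_def weight_tail_def del: list.map prod_list.Cons)
qed

section \<open>Moments and total mass of the weight\<close>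

definition weight_moment :: "real \<Rightarrow> nat \<Rightarrow> real" where
  "weight_moment q n = (\<Sum>k. q ^ (Suc n * k) * weight_tail q k)"

lemma summable_weight_moment:
  assumes "0 < q" "q < 1"
  shows "summable (\<lambda>k. q ^ (Suc n * k) * weight_tail q k)"
proof (rule summable_comparison_test')
  show "summable (\<lambda>k. q ^ k)"
    using assms by (simp add: summable_geometric)
  show "norm (q ^ (Suc n * k) * weight_tail q k) \<le> q ^ k" for k
  proof -
    have "q ^ (Suc n * k) * weight_tail q k \<le> q ^ k * 1"
      using assms weight_tail_nonneg_le_one[OF assms, of k]
      by (intro mult_mono power_decreasing) auto
    then show ?thesis
      using assms weight_tail_nonneg_le_one[OF assms, of k] by (simp add: abs_mult)
  qed
qed

text \<open>A discrete integration by parts. Up to normalisation, \<open>weight_moment q n\<close>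
  is half the \<open>n\<close>-th absolute moment. In the difference of the two moments, the factor
  \<open>1 - q^(2k)\<close> kills the term \<open>k = 0\<close> and turns
  \<open>weight_tail q k\<close> into \<open>weight_tail q (k - 1)\<close>; shifting the index gives
  back the \<open>n\<close>-th moment.\<close>

lemma weight_moment_Suc:
  assumes "0 < q" "q < 1"
  shows "weight_moment q (n + 2) = (1 - q ^ Suc n) * weight_moment q n"
proof -
  let ?f = "\<lambda>m k. q ^ (Suc m * k) * weight_tail q k"
  have "weight_moment q n - weight_moment q (n + 2) = (\<Sum>k. ?f n k - ?f (n + 2) k)"
    unfolding weight_moment_def by (intro suminf_diff summable_weight_moment assms)
  also have "\<dots> = (\<Sum>k. ?f n (Suc k) - ?f (n + 2) (Suc k))"
    using suminf_split_head[OF summable_diff[OF summable_weight_moment[OF assms, of n]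
        summable_weight_moment[OF assms, of "n + 2"]]] by simp
  also have "\<dots> = (\<Sum>k. q ^ Suc n * ?f n k)"
  proof (intro arg_cong[of _ _ suminf] ext)
    fix k
    have "q ^ (Suc (n + 2) * Suc k) = q ^ (Suc n * Suc k) * q ^ (2 * Suc k)"
      unfolding power_add [symmetric] by (rule arg_cong[of _ _ "power q"]) simp
    then have "?f n (Suc k) - ?f (n + 2) (Suc k) =
        q ^ (Suc n * Suc k) * ((1 - q ^ (2 * Suc k)) * weight_tail q (Suc k))"
      by (simp only:) (simp only: algebra_simps)
    also have "\<dots> = q ^ (Suc n * Suc k) * weight_tail q k"
      by (simp only: weight_tail_Suc[OF assms, of k])
    also have "\<dots> = q ^ Suc n * ?f n k"
      unfolding mult_Suc_right power_add by simp
    finally show "?f n (Suc k) - ?f (n + 2) (Suc k) = q ^ Suc n * ?f n k" .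
  qed
  also have "\<dots> = q ^ Suc n * weight_moment q n"
    unfolding weight_moment_def by (intro suminf_mult summable_weight_moment assms)
  finally show ?thesis
    by (simp add: algebra_simps)
qed

lemma weight_moment_even:
  assumes "0 < q" "q < 1"
  shows "weight_moment q (2 * m) = weight_moment q 0 * (\<Prod>i<m. 1 - q ^ (2 * i + 1))"
proof (induction m)
  case (Suc m)
  have "weight_moment q (2 * Suc m) = (1 - q ^ Suc (2 * m)) * weight_moment q (2 * m)"
    using weight_moment_Suc[OF assms, of "2 * m"] by simp
  then show ?case
    using Suc by simp
qed simp

text \<open>All terms with \<open>k > 0\<close> are suppressed by at least \<open>q^m\<close>, so
  only the one at \<open>k = 0\<close> survives. Since the recursion reduces even moments to
  \<open>weight_moment q 0\<close>, this limit fixes the total mass.\<close>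

lemma weight_moment_tendsto:
  assumes "0 < q" "q < 1"
  shows "(\<lambda>m. weight_moment q (2 * m)) \<longlonglongrightarrow> weight_tail q 0"
proof -
  let ?f = "\<lambda>m k. q ^ (Suc m * k) * weight_tail q k"
  have "\<bar>weight_moment q (2 * m) - weight_tail q 0\<bar> \<le> (q ^ m) * weight_moment q 0" for m
  proof -
    define S where "S = (\<lambda>m. \<Sum>k. ?f m (Suc k))"
    have sm: "summable (\<lambda>k. ?f m (Suc k))" for m
      using summable_weight_moment[OF assms, of m] by (subst summable_Suc_iff)
    have head: "weight_moment q m = weight_tail q 0 + S m" for m
      unfolding weight_moment_def S_def
      by (subst suminf_split_head[OF summable_weight_moment[OF assms, of m]]) simp
    have "0 \<le> S (2 * m)"
      unfolding S_def using assms weight_tail_nonneg_le_one[OF assms]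
      by (intro suminf_nonneg sm) auto
    moreover have "S (2 * m) \<le> (\<Sum>k. q ^ m * ?f 0 (Suc k))"
      unfolding S_def
    proof (intro suminf_le summable_mult)
      fix k
      have "q ^ (Suc (2 * m) * Suc k) \<le> q ^ (m + Suc k)"
        using assms by (intro power_decreasing) auto
      then have "q ^ (Suc (2 * m) * Suc k) * weight_tail q (Suc k) \<le> q ^ (m + Suc k) * weight_tail q (Suc k)"
        using weight_tail_nonneg_le_one[OF assms] by (intro mult_right_mono)
      then show "?f (2 * m) (Suc k) \<le> q ^ m * ?f 0 (Suc k)"
        by (simp add: power_add mult_ac)
    qed (rule sm)+
    moreover have "(\<Sum>k. q ^ m * ?f 0 (Suc k)) = q ^ m * S 0"
      unfolding S_def by (intro suminf_mult sm)
    moreover have "q ^ m * S 0 \<le> q ^ m * weight_moment q 0"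
      using head[of 0] weight_tail_nonneg_le_one[OF assms, of 0] assms by (intro mult_left_mono) auto
    ultimately show ?thesis
      using head[of "2 * m"] by (simp only: abs_le_iff) linarith
  qed
  then have bound: "norm (weight_moment q (2 * m) - weight_tail q 0) \<le> q ^ m * weight_moment q 0" for m
    by simp
  have "(\<lambda>m. q ^ m * weight_moment q 0) \<longlonglongrightarrow> 0"
    using assms by (intro tendsto_mult_left_zero LIMSEQ_realpow_zero) auto
  from Lim_null_comparison[OF always_eventually[OF allI[OF bound]] this]
  have "(\<lambda>m. weight_moment q (2 * m) - weight_tail q 0) \<longlonglongrightarrow> 0" .
  then show ?thesis
    by (simp add: LIM_zero_iff)
qed

text \<open>Letting \<open>m\<close> tend to infinity in the product formula for the even moments
  shows that \<open>weight_moment q 0\<close> times \<open>(q;q^2)_\<infinity>\<close> is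
  \<open>(q^2;q^2)_\<infinity>\<close>. The rest is a rearrangement of infinite products.\<close>

lemma qpoch_inf_normalisation:
  assumes "0 < q" "q < 1"
  shows "2 * weight_moment q 0 = qpoch_inf [q, - 1, - q] q" (is ?eq)
    and "weight_moment q 0 > 0"
proof -
  define A where "A = (\<Prod>i. 1 - q ^ Suc i)"
  define B where "B = (\<Prod>i. 1 + q ^ Suc i)"
  define B0 where "B0 = (\<Prod>i. 1 + q ^ i)"
  define W where "W = weight_tail q 0"
  have cA: "convergent_prod (\<lambda>i. 1 - q ^ Suc i)"
    using convergent_prod_geometric[OF assms, of "- q"] by simp
  have cB: "convergent_prod (\<lambda>i. 1 + q ^ Suc i)"
    using convergent_prod_geometric[OF assms, of "q"] by simp
  have cB0: "convergent_prod (\<lambda>i. 1 + q ^ i)"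
    using convergent_prod_geometric[OF assms, of "1"] by simp
  have qlt: "q ^ Suc i < 1" for i
    using assms by (intro power_Suc_less_one) auto
  have nz: "A \<noteq> 0"
    unfolding A_def using qlt by (intro prodinf_nonzero cA) (metis less_irrefl right_minus_eq)
  have BB: "B0 = 2 * B"
    unfolding B0_def B_def using prodinf_split_head[OF cB0] by simp
  have W: "W = A * B"
  proof -
    have "A * B = (\<Prod>i. (1 - q ^ Suc i) * (1 + q ^ Suc i))"
      unfolding A_def B_def by (rule prodinf_mult[OF cA cB])
    also have "\<dots> = W"
      unfolding W_def weight_tail_def
      by (intro prodinf_cong, simp only: mult_2 power_add) (simp add: algebra_simps)
    finally show ?thesis ..
  qed
  have D: "qpoch_inf [q, - 1, - q] q = A * (B0 * B)"
  proof -
    have "A * (B0 * B) = (\<Prod>i. (1 - q ^ Suc i) * ((1 + q ^ i) * (1 + q ^ Suc i)))"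
      unfolding A_def B_def B0_def
      by (subst prodinf_mult[OF cB0 cB], rule prodinf_mult[OF cA convergent_prod_mult[OF cB0 cB]])
    then show ?thesis
      by (simp add: qpoch_inf_def)
  qed
  \<comment> \<open>A further factor \<open>W = (q^2;q^2)_\<infinity>\<close> completes the odd
    factors to the full product \<open>A\<close>. With \<open>W = A * B\<close> the half mass
    becomes \<open>A * B * B\<close>, while the denominator is
    \<open>A * (2 * B) * B\<close>.\<close>
  have wp: "weight_moment q 0 * A = W * W"
  proof -
    have lA: "(\<lambda>n. \<Prod>i<n. 1 - q ^ Suc i) \<longlonglongrightarrow> A"
      using convergent_prod_LIMSEQ[OF cA] unfolding A_def
      by (subst (asm) lessThan_Suc_atMost [symmetric]) (rule LIMSEQ_imp_Suc)
    have lW: "(\<lambda>n. \<Prod>i<n. 1 - q ^ (2 * Suc i)) \<longlonglongrightarrow> W"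
    proof -
      have "(\<lambda>n. \<Prod>i\<le>n. 1 - q ^ (2 * Suc i)) \<longlonglongrightarrow> W"
        using convergent_prod_LIMSEQ[OF convergent_prod_weight_tail[OF assms, of 0]]
        by (simp add: W_def weight_tail_def del: mult_Suc_right)
      then show ?thesis
        by (subst (asm) lessThan_Suc_atMost [symmetric]) (rule LIMSEQ_imp_Suc)
    qed
    have split: "(\<Prod>i<2 * n. 1 - q ^ Suc i) = (\<Prod>i<n. 1 - q ^ (2 * i + 1)) * (\<Prod>i<n. 1 - q ^ (2 * Suc i))" for n
      by (induction n) (simp_all add: mult_ac)
    have "(\<lambda>n. weight_moment q 0 * (\<Prod>i<2 * n. 1 - q ^ Suc i)) \<longlonglongrightarrow> weight_moment q 0 * A"
      by (intro tendsto_intros filterlim_compose[OF lA] mult_nat_left_at_top) auto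
    moreover have "(\<lambda>n. weight_moment q (2 * n) * (\<Prod>i<n. 1 - q ^ (2 * Suc i))) \<longlonglongrightarrow> W * W"
      unfolding W_def[symmetric] by (intro tendsto_intros weight_moment_tendsto[OF assms, folded W_def] lW)
    moreover have "weight_moment q (2 * n) * (\<Prod>i<n. 1 - q ^ (2 * Suc i)) =
        weight_moment q 0 * (\<Prod>i<2 * n. 1 - q ^ Suc i)" for n
      unfolding weight_moment_even[OF assms, of n] split by simp
    ultimately show ?thesis
      using LIMSEQ_unique by auto
  qed
  have eq: "weight_moment q 0 = A * B * B"
    using wp nz unfolding W by (simp add: field_simps)
  then show ?eq
    unfolding D BB by simp
  have "B \<noteq> 0"
    unfolding B_def using assms by (intro prodinf_nonzero cB) (smt (verit) zero_less_power)
  moreover have "weight_moment q 0 \<ge> 0"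
    unfolding weight_moment_def using assms weight_tail_nonneg_le_one[OF assms]
    by (intro suminf_nonneg summable_weight_moment[OF assms]) auto
  ultimately show "weight_moment q 0 > 0"
    using nz eq by (metis less_eq_real_def mult_eq_0_iff)
qed

section \<open>Orthogonality and lattice paths\<close>

definition qherm_moment :: "real \<Rightarrow> nat \<Rightarrow> real" where
  "qherm_moment q n = (if odd n then 0 else \<Prod>i<n div 2. 1 - q ^ (2 * i + 1))"

text \<open>Integration against the weight, encoded as a finite sum over coefficients so that
  orthogonality becomes pure algebra.\<close>

definition qherm_functional :: "real \<Rightarrow> real poly \<Rightarrow> real" where
  "qherm_functional q p = (\<Sum>i\<le>degree p. coeff p i * qherm_moment q i)"

lemma qherm_functional_eq:
  assumes "degree p \<le> n"
  shows "qherm_functional q p = (\<Sum>i\<le>n. coeff p i * qherm_moment q i)"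
  unfolding qherm_functional_def
  using assms by (intro sum.mono_neutral_left) (auto simp: coeff_eq_0)

lemma qherm_functional_diff:
  "qherm_functional q (p - r) = qherm_functional q p - qherm_functional q r"
proof -
  define n where "n = max (degree p) (degree r)"
  have "degree p \<le> n" "degree r \<le> n" "degree (p - r) \<le> n"
    by (auto simp: n_def degree_diff_le)
  then show ?thesis
    by (simp add: qherm_functional_eq[of _ n] left_diff_distrib sum_subtractf)
qed

lemma qherm_functional_add:
  "qherm_functional q (p + r) = qherm_functional q p + qherm_functional q r"
proof -
  define n where "n = max (degree p) (degree r)"
  have "degree p \<le> n" "degree r \<le> n" "degree (p + r) \<le> n"
    by (auto simp: n_def degree_add_le)
  then show ?thesis
    by (simp add: qherm_functional_eq[of _ n] distrib_right sum.distrib)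
qed

lemma qherm_functional_smult: "qherm_functional q (smult c p) = c * qherm_functional q p"
  by (simp add: qherm_functional_eq[of "smult c p" "degree p"] degree_smult_le
      qherm_functional_def sum_distrib_left mult.assoc)

lemma qherm_functional_0 [simp]: "qherm_functional q 0 = 0"
  by (simp add: qherm_functional_def)

lemma qherm_functional_sum:
  "qherm_functional q (\<Sum>i\<in>A. f i) = (\<Sum>i\<in>A. qherm_functional q (f i))"
  by (induction A rule: infinite_finite_induct) (simp_all add: qherm_functional_add)

lemma qherm_functional_monom: "qherm_functional q (monom 1 k) = qherm_moment q k"
  by (simp add: qherm_functional_eq[of _ k] degree_monom_eq if_distrib[of "\<lambda>x. x * _"] cong: if_cong)

text \<open>By linearity only monomials matter. Odd ones cancel on the symmetric support; even ones
  give \<open>2 / D\<close> times \<open>weight_moment\<close>, where \<open>D\<close> is twice the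
  zeroth moment.\<close>

lemma jackson_integral_poly:
  assumes "0 < q" "q < 1"
  shows "jackson_integral q 1 (\<lambda>x. poly p x * qherm_weight q x) = (1 - q) * qherm_functional q p"
proof -
  define D where "D = qpoch_inf [q, - 1, - q] q"
  have D: "D = 2 * weight_moment q 0" "weight_moment q 0 > 0"
    using qpoch_inf_normalisation[OF assms] by (simp_all add: D_def)
  have w: "qherm_weight q (q ^ k) = weight_tail q k / D"
      "qherm_weight q (- (q ^ k)) = weight_tail q k / D" for k
    using qherm_weight_at_points[OF assms, of _ k] unfolding D_def by blast+
  have *: "(\<lambda>k. q ^ k * (((q ^ k) ^ i + (- (q ^ k)) ^ i) * (weight_tail q k / D))) sums qherm_moment q i" for i
  proof (cases "odd i")
    case True
    then show ?thesis by (simp add: qherm_moment_def)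
  next
    case False
    then obtain m where m: "i = 2 * m" by blast
    have "(\<lambda>k. q ^ (Suc i * k) * weight_tail q k) sums weight_moment q i"
      unfolding weight_moment_def by (rule summable_sums[OF summable_weight_moment[OF assms]])
    from sums_mult[OF this, of "2 / D"]
    have "(\<lambda>k. 2 / D * (q ^ (Suc i * k) * weight_tail q k)) sums (2 / D * weight_moment q i)" .
    moreover have "2 / D * weight_moment q i = qherm_moment q i"
      unfolding m weight_moment_even[OF assms] using D by (simp add: qherm_moment_def)
    moreover have "q ^ k * (((q ^ k) ^ i + (- (q ^ k)) ^ i) * (weight_tail q k / D)) =
        2 / D * (q ^ (Suc i * k) * weight_tail q k)" for k
    proof -
      have "(q ^ k) ^ i + (- (q ^ k)) ^ i = 2 * q ^ (i * k)"
        unfolding m by (simp add: power_mult [symmetric] mult_ac)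
      then show ?thesis by (simp add: power_add)
    qed
    ultimately show ?thesis by (simp only:)
  qed
  have "(\<lambda>k. \<Sum>i\<le>degree p. coeff p i * (q ^ k * (((q ^ k) ^ i + (- (q ^ k)) ^ i) * (weight_tail q k / D))))
      sums qherm_functional q p"
    unfolding qherm_functional_def by (intro sums_sum sums_mult *)
  moreover have "(\<Sum>i\<le>degree p. coeff p i * (q ^ k * (((q ^ k) ^ i + (- (q ^ k)) ^ i) * (weight_tail q k / D)))) =
      1 * q ^ k * (poly p (1 * q ^ k) * qherm_weight q (1 * q ^ k) +
        poly p (- (1 * q ^ k)) * qherm_weight q (- (1 * q ^ k)))" for k
    by (simp add: poly_altdef w sum_distrib_left sum_distrib_right sum.distrib [symmetric] algebra_simps)
  ultimately show ?thesis
    unfolding jackson_integral_def by (simp add: sums_iff)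
qed

lemma triangle_Suc: "Suc n * (Suc n - 1) div 2 = n * (n - 1) div 2 + n"
proof -
  have "Suc n * n = n * (n - 1) + 2 * n"
    by (cases n) auto
  then show ?thesis by simp
qed

text \<open>The closed form, \<open>(q;q)_k / (q^2;q^2)_m\<close> with
  \<open>m = (k - n) / 2\<close> times a power of \<open>q\<close>, is stable under the three-term
  recurrence, so induction on \<open>n\<close> for all \<open>k\<close> at once proves it.\<close>

lemma qherm_functional_monom_qherm:
  assumes "0 < q" "q < 1"
  shows "qherm_functional q (monom 1 k * qherm q n) =
    (if n \<le> k \<and> even (k - n)
     then qpoch q q k / (\<Prod>i<(k - n) div 2. 1 - q ^ (2 * i + 2)) * q ^ (n * (n - 1) div 2) else 0)"
proof -
  define e where "e = (\<lambda>m. \<Prod>i<m. 1 - q ^ (2 * i + 2))"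
  have lt: "q ^ Suc m < 1" for m
    using assms by (intro power_Suc_less_one) auto
  have e0: "e 0 = 1" and eS: "e (Suc m) = e m * (1 - q ^ (2 * m + 2))" and e: "e m \<noteq> 0" for m
    using lt[of "2 * i + 1" for i] by (auto simp: e_def prod_zero_iff) (metis less_irrefl)
  have r: "qpoch q q 0 = 1" "qpoch q q (Suc m) = qpoch q q m * (1 - q ^ Suc m)" for m
    by (simp_all add: qpoch_def)
  \<comment> \<open>The identity \<open>(q;q^2)_m = (q;q)_(2m) / (q^2;q^2)_m\<close> brings the
    moments into the shape claimed for \<open>n = 0\<close>.\<close>
  have mu: "qherm_moment q (2 * m) = qpoch q q (2 * m) / e m" for m
  proof (induction m)
    case (Suc m)
    have "qherm_moment q (2 * Suc m) = qherm_moment q (2 * m) * (1 - q ^ (2 * m + 1))"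
      by (simp add: qherm_moment_def)
    then show ?case
      using e[of m] e[of "Suc m"] lt[of "2 * m + 1"] by (simp add: Suc r eS divide_simps)
  qed (simp add: qherm_moment_def r e0)
  have "(k < n \<or> odd (k + n) \<longrightarrow> qherm_functional q (monom 1 k * qherm q n) = 0) \<and>
      (\<forall>m. k = n + 2 * m \<longrightarrow> qherm_functional q (monom 1 k * qherm q n) =
        qpoch q q k / e m * q ^ (n * (n - 1) div 2))" for k
  proof (induction n arbitrary: k rule: induct_nat_012)
    case 0
    show ?case
      by (auto simp: qherm_functional_monom mu) (simp add: qherm_moment_def)
  next
    case 1
    have "monom 1 k * qherm q (Suc 0) = monom 1 (Suc k)"
      by (simp add: mult.commute[of _ "[:0, 1:]"] monom_Suc)
    moreover have "qherm_moment q (Suc k) = qpoch q q k / e m" if "k = Suc 0 + 2 * m" for m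
    proof -
      have "qherm_moment q (Suc k) = qpoch q q (Suc (2 * m + 1)) / e (Suc m)"
        using mu[of "Suc m"] that by simp
      then show ?thesis
        using that e[of m] e[of "Suc m"] lt[of "2 * m + 1"] by (simp add: r eS)
    qed
    moreover have "qherm_moment q (Suc k) = 0" if "even k"
      using that by (simp add: qherm_moment_def)
    ultimately show ?case
      by (auto simp: qherm_functional_monom)
  next
    case (ge2 n k)
    let ?F = "\<lambda>k n. qherm_functional q (monom 1 k * qherm q n)"
    let ?T = "\<lambda>n. n * (n - 1) div 2"
    have "monom 1 k * qherm q (Suc (Suc n)) = monom 1 (Suc k) * qherm q (Suc n) -
        smult (q ^ n * (1 - q ^ Suc n)) (monom 1 k * qherm q n)"
      by (simp add: monom_Suc algebra_simps)
    then have rec: "?F k (Suc (Suc n)) = ?F (Suc k) (Suc n) - q ^ n * (1 - q ^ Suc n) * ?F k n"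
      by (simp only: qherm_functional_diff qherm_functional_smult)
    have T: "q ^ ?T (Suc n) = q ^ ?T n * q ^ n" for n
      by (simp only: triangle_Suc power_add)
    have "?F k (Suc (Suc n)) = 0" if "k < Suc (Suc n) \<or> odd (k + Suc (Suc n))"
    \<comment> \<open>For \<open>k = n\<close> both terms of the recurrence are nonzero and cancel.
      Otherwise both vanish by induction; \<open>k = n + 1\<close> has the wrong parity.\<close>
    proof (cases "k = n")
      case True
      have "?F (Suc n) (Suc n) = qpoch q q (Suc n) / e 0 * q ^ ?T (Suc n)"
        using ge2(2)[of "Suc n"] by simp
      moreover have "?F n n = qpoch q q n / e 0 * q ^ ?T n"
        using ge2(1)[of n] by simp
      ultimately show ?thesis
        unfolding rec[unfolded True] True T r e0 by simp
    next
      case False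
      have "k < n \<or> odd (k + n)"
        using that False by (cases "k = Suc n") auto
      then have "?F k n = 0" "?F (Suc k) (Suc n) = 0"
        using ge2(1)[of k] ge2(2)[of "Suc k"] by auto
      then show ?thesis
        unfolding rec by simp
    qed
    moreover have "?F k (Suc (Suc n)) = qpoch q q k / e m * q ^ ?T (Suc (Suc n))"
      if k: "k = Suc (Suc n) + 2 * m" for m
    proof -
      have "?F k n = qpoch q q k / e (Suc m) * q ^ ?T n"
        using ge2(1)[of k] k by simp
      moreover have "?F (Suc k) (Suc n) = qpoch q q k * (1 - q ^ Suc k) / e (Suc m) * (q ^ ?T n * q ^ n)"
        using ge2(2)[of "Suc k"] k unfolding T[symmetric] r by simp
      ultimately have "?F k (Suc (Suc n)) =
          qpoch q q k * q ^ ?T n * q ^ n * ((1 - q ^ Suc k) - (1 - q ^ Suc n)) / e (Suc m)"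
        unfolding rec by (simp add: algebra_simps diff_divide_distrib)
      also have "(1 - q ^ Suc k) - (1 - q ^ Suc n) = q ^ Suc n * (1 - q ^ (2 * m + 2))"
        unfolding k by (simp add: algebra_simps power_add)
      also have "qpoch q q k * q ^ ?T n * q ^ n * (q ^ Suc n * (1 - q ^ (2 * m + 2))) / e (Suc m) =
          qpoch q q k / e m * (q ^ ?T n * q ^ n * q ^ Suc n)"
        using e[of m] lt[of "2 * m + 1"] unfolding eS by (simp add: divide_simps)
      also have "q ^ ?T n * q ^ n * q ^ Suc n = q ^ ?T (Suc (Suc n))"
        by (simp only: T)
      finally show ?thesis .
    qed
    ultimately show ?case by blast
  qed
  note * = this[of k]
  show ?thesis
  proof (cases "n \<le> k \<and> even (k - n)")
    case True
    then obtain m where "k - n = 2 * m" by blast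
    with True have "k = n + 2 * m" by simp
    then show ?thesis
      using * by (simp add: e_def)
  next
    case False
    then have "k < n \<or> odd (k + n)" by auto
    then show ?thesis using * False by auto
  qed
qed

lemma degree_qherm: "degree (qherm q n) \<le> n"
proof (induction n rule: induct_nat_012)
  case (ge2 n)
  have "degree ([:0, 1:] * qherm q (Suc n)) \<le> Suc (Suc n)"
    using ge2(2) degree_pCons_le[of 0 "qherm q (Suc n)"] by simp
  then show ?case
    using ge2(1) by (auto intro!: degree_diff_le order.trans[OF degree_smult_le])
qed simp_all

lemma coeff_qherm: "coeff (qherm q n) n = 1"
proof (induction n rule: induct_nat_012)
  case (ge2 n)
  have "coeff (qherm q n) (Suc (Suc n)) = 0"
    using degree_qherm[of q n] by (intro coeff_eq_0) simp
  then show ?case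
    using ge2 by simp
qed simp_all

text \<open>Expanding the factor of smaller degree into monomials leaves at most its leading term,
  whose coefficient is 1, because lower powers are orthogonal to the other factor.\<close>

lemma qherm_orthogonal:
  assumes "0 < q" "q < 1"
  shows "qherm_functional q (qherm q n * qherm q m) =
    (if n = m then qpoch q q n * q ^ (n * (n - 1) div 2) else 0)"
proof -
  have *: "qherm_functional q (qherm q i * qherm q j) =
      (if i = j then qpoch q q j * q ^ (j * (j - 1) div 2) else 0)" if "i \<le> j" for i j
  proof -
    have "qherm q i * qherm q j = (\<Sum>k\<le>i. smult (coeff (qherm q i) k) (monom 1 k * qherm q j))"
      by (subst poly_as_sum_of_monoms'[OF degree_qherm[of q i], symmetric])
        (simp add: sum_distrib_right smult_monom flip: mult_smult_left)
    then have "qherm_functional q (qherm q i * qherm q j) =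
        (\<Sum>k\<le>i. coeff (qherm q i) k * qherm_functional q (monom 1 k * qherm q j))"
      by (simp add: qherm_functional_sum qherm_functional_smult)
    also have "\<dots> = (\<Sum>k\<le>i. if k = j then qpoch q q j * q ^ (j * (j - 1) div 2) else 0)"
      using that by (intro sum.cong)
        (auto simp: qherm_functional_monom_qherm[OF assms] coeff_qherm)
    finally show ?thesis
      using that by simp
  qed
  show ?thesis
    using *[of n m] *[of m n] by (cases "n \<le> m") (auto simp: mult.commute)
qed

text \<open>The total weight of the lattice paths with \<open>u\<close> up-steps and \<open>d\<close> down-steps that lead from
  height \<open>d - u\<close> to height \<open>0\<close>; a down-step from \<open>s\<close> to \<open>s - 1\<close> has weight \<open>v s\<close>.\<close>

fun path_sum :: "(int \<Rightarrow> real) \<Rightarrow> nat \<Rightarrow> nat \<Rightarrow> real" where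
  "path_sum v u 0 = 1"
| "path_sum v 0 (Suc d) = v (int (Suc d)) * path_sum v 0 d"
| "path_sum v (Suc u) (Suc d) =
     path_sum v u (Suc d) + v (int d - int u) * path_sum v (Suc u) d"

text \<open>By the three-term recurrence each factor \<open>x\<close> raises \<open>n\<close> with
  weight 1 or lowers it with weight \<open>q^(n-1) (1 - q^n)\<close>, and orthogonality forces the
  path to end at \<open>j\<close>. The height is \<open>n - j\<close>. Giving one of the
  \<open>d\<close> factors \<open>q\<close> to each down-step turns its weight into
  \<open>q^n (1 - q^n)\<close>.\<close>

lemma qherm_path_sum:
  fixes q :: real and j :: nat
  assumes q: "0 < q" "q < 1"
  assumes v: "\<And>s n. int n = int j + s \<Longrightarrow> v s = q ^ n * (1 - q ^ n)"
  assumes "n + u = j + d"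
  shows "q ^ d * qherm_functional q (monom 1 (u + d) * qherm q n * qherm q j) =
    qpoch q q j * q ^ (j * (j - 1) div 2) * path_sum v u d"
proof -
  define E where "E = (\<lambda>r n. qherm_functional q (monom 1 r * qherm q n * qherm q j))"
  define h where "h = qpoch q q j * q ^ (j * (j - 1) div 2)"
  have E0: "E 0 n = (if n = j then h else 0)" for n
    by (simp add: E_def qherm_orthogonal[OF q] h_def)
  have ES0: "E (Suc r) 0 = E r (Suc 0)" for r
    by (simp add: E_def monom_Suc mult_ac)
  have ESS: "E (Suc r) (Suc n) = E r (Suc (Suc n)) + q ^ n * (1 - q ^ Suc n) * E r n" for r n
  proof -
    have "monom 1 (Suc r) * qherm q (Suc n) * qherm q j = monom 1 r * qherm q (Suc (Suc n)) * qherm q j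
        + smult (q ^ n * (1 - q ^ Suc n)) (monom 1 r * qherm q n * qherm q j)"
      by (simp add: monom_Suc algebra_simps)
    then show ?thesis
      by (simp only: E_def qherm_functional_add qherm_functional_smult)
  qed
  \<comment> \<open>In \<open>r\<close> steps the index moves by at most \<open>r\<close>, so
    \<open>j\<close> is out of reach.\<close>
  have vanish: "E r n = 0" if "j + r < n \<or> n + r < j" for r n
    using that
  proof (induction r arbitrary: n)
    case 0
    then show ?case by (auto simp: E0)
  next
    case (Suc r)
    then show ?case by (cases n) (auto simp: ES0 ESS)
  qed
  have "q ^ d * E (u + d) n = h * path_sum v u d" if "n + u = j + d"
    using that
  proof (induction "u + d" arbitrary: u d n)
    case 0
    then show ?case by (simp add: E0)
  next
    case (Suc r)
    have v': "v (int d - int u) = q ^ n * (1 - q ^ n)"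
      using Suc.prems by (intro v) linarith
    consider "d = 0" | d' where "u = 0" "d = Suc d'" | u' d' where "u = Suc u'" "d = Suc d'"
      by (metis not0_implies_Suc)
    then show ?case
    proof cases
      case 1
      then have u: "u = Suc r" "n + Suc r = j" using Suc by auto
      \<comment> \<open>Every remaining step must go up; after a down-step, \<open>j\<close> could
        no longer be reached.\<close>
      have "E (Suc r) n = E r (Suc n)"
      proof (cases n)
        case (Suc n')
        then show ?thesis using ESS[of r n'] vanish[of r n'] u by simp
      qed (simp add: ES0)
      then show ?thesis
        using Suc.hyps(1)[of r 0 "Suc n"] 1 u by simp
    next
      case 2
      then obtain n' where n: "n = Suc n'" "n' = j + d'" using Suc.prems by (cases n) auto
      have "E (Suc r) n = q ^ n' * (1 - q ^ n) * E r n'"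
        using ESS[of r n'] vanish[of r "Suc n"] Suc.hyps(2) 2 n by simp
      moreover have "q ^ d' * E r n' = h * path_sum v 0 d'"
        using Suc.hyps(1)[of 0 d' n'] Suc.hyps(2) 2 n by simp
      ultimately show ?thesis
        using v' 2 n Suc.hyps(2) by (simp add: mult_ac)
    next
      case 3
      have up: "q ^ Suc d' * E r (Suc n) = h * path_sum v u' (Suc d')"
        using Suc.hyps(1)[of u' "Suc d'" "Suc n"] Suc.hyps(2) 3 Suc.prems by simp
      show ?thesis
      proof (cases n)
        case 0
        \<comment> \<open>The recurrence has no down-step at \<open>n = 0\<close>. The one in
          \<open>path_sum\<close> does no harm, because its weight contains
          \<open>1 - q^0 = 0\<close>; this removes all paths to negative indices.\<close>
        then have "v (int d' - int u') = 0" using v' 3 by simp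
        then show ?thesis
          using up 3 0 ES0[of r] Suc.hyps(2) by simp
      next
        case (Suc n')
        have "q ^ d' * E r n' = h * path_sum v (Suc u') d'"
          using Suc.hyps(1)[of "Suc u'" d' n'] Suc.hyps(2) 3 Suc.prems Suc by simp
        moreover have "v (int d' - int u') = q ^ n * (1 - q ^ n)"
          using v' 3 by simp
        moreover have "q ^ Suc d' * E (Suc r) n =
            q ^ Suc d' * E r (Suc n) + q ^ n * (1 - q ^ n) * (q ^ d' * E r n')"
          unfolding Suc ESS[of r n'] by (simp add: algebra_simps)
        ultimately show ?thesis
          using up 3 Suc.hyps(2) by (simp only: path_sum.simps) (simp add: algebra_simps)
      qed
    qed
  qed
  then show ?thesis
    using assms(4) by (simp add: E_def h_def)
qed

text \<open>Even powers make the integrand a polynomial times the weight. The norms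
  \<open>h j\<close> cancel against the prefactors of the path sums, and \<open>1 / (1 - q)\<close>
  against the Jackson factor.\<close>

lemma qGUE_moment_path_sum:
  fixes q :: real
  assumes q: "0 < q" "q < 1"
  assumes v: "\<And>j s n. int n = int j + s \<Longrightarrow> v j s = q ^ n * (1 - q ^ n)"
  shows "q ^ p * qGUE_moment q N p = (\<Sum>j<N. path_sum (v j) p p)"
proof -
  define h where "h = (\<lambda>j. qpoch q q j * q ^ (j * (j - 1) div 2))"
  have h: "h j \<noteq> 0" for j
  proof -
    have "q * q ^ i < 1" for i
      using q power_Suc_less_one[of q i] by simp
    then show ?thesis
      using q by (auto simp: h_def qpoch_def) (metis less_irrefl)
  qed
  define P where "P = smult (1 / (1 - q)) (monom 1 (2 * p) *
    (\<Sum>j<N. smult (1 / h j) (qherm q j * qherm q j)))"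
  have "\<bar>x\<bar> ^ (2 * p) * qGUE_density q N x = poly P x * qherm_weight q x" for x
    by (simp add: qGUE_density_def P_def h_def poly_sum poly_monom power_even_abs power2_eq_square)
  then have "qGUE_moment q N p = (1 - q) * qherm_functional q P"
    by (simp only: qGUE_moment_def jackson_integral_poly[OF q])
  also have "\<dots> = (\<Sum>j<N. qherm_functional q (monom 1 (p + p) * qherm q j * qherm q j) / h j)"
    using q by (simp add: P_def sum_distrib_left qherm_functional_smult qherm_functional_sum mult.assoc mult_2)
  finally have "q ^ p * qGUE_moment q N p =
      (\<Sum>j<N. q ^ p * qherm_functional q (monom 1 (p + p) * qherm q j * qherm q j) / h j)"
    by (simp add: sum_distrib_left)
  moreover have "q ^ p * qherm_functional q (monom 1 (p + p) * qherm q j * qherm q j) =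
      h j * path_sum (v j) p p" for j
    unfolding h_def by (rule qherm_path_sum[OF q v]) auto
  ultimately show ?thesis
    using h by simp
qed

section \<open>Expansion of the path sums\<close>

text \<open>Swapping the roles of up- and down-steps moves the weights from the down-steps to the up-steps.
  This changes the weight of every path by a factor \<open>\<gamma>\<close> that depends on its starting height only.\<close>

lemma path_sum_reflect:
  assumes nz: "\<And>s. v s \<noteq> 0"
  shows "path_sum v p p = path_sum (\<lambda>s. v (1 - s)) p p"
proof -
  \<comment> \<open>The choice ensures \<open>\<gamma> 0 = 1\<close> and
    \<open>\<gamma> s = v s * \<gamma> (s - 1)\<close>. Rescaling each height \<open>s\<close> by
    \<open>\<gamma> s\<close> turns the weight of the down-step from \<open>s\<close> into 1 and
    gives weight \<open>v s\<close> to the up-step from \<open>s - 1\<close> to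
    \<open>s\<close>.\<close>
  define \<gamma> where "\<gamma> = (\<lambda>s. if s \<ge> 0 then \<Prod>i<nat s. v (int i + 1) else 1 / (\<Prod>i<nat (- s). v (- int i)))"
  have \<gamma>0: "\<gamma> 0 = 1" by (simp add: \<gamma>_def)
  have \<gamma>: "\<gamma> s = v s * \<gamma> (s - 1)" for s
  proof (cases "s > 0")
    case True
    then obtain n where "s = int (Suc n)"
      by (metis gr0_implies_Suc zero_less_imp_eq_int)
    then show ?thesis by (simp add: \<gamma>_def nat_add_distrib add.commute)
  next
    case False
    then obtain n where n: "s = - int n"
      by (metis nonpos_int_cases not_less)
    have "\<gamma> (s - 1) = 1 / (\<Prod>i<Suc n. v (- int i))"
      unfolding \<gamma>_def n by (auto simp: nat_add_distrib)
    moreover have "\<gamma> s = 1 / (\<Prod>i<n. v (- int i))"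
      unfolding \<gamma>_def n by auto
    ultimately show ?thesis using nz[of s] n by simp
  qed
  \<comment> \<open>Changing the sign of the heights makes that up-step a down-step from
    \<open>1 - s\<close> to \<open>- s\<close>; hence the weights \<open>v (1 - s)\<close> and the
    exchange of \<open>u\<close> and \<open>d\<close>.\<close>
  have "path_sum v u d = \<gamma> (int d - int u) * path_sum (\<lambda>s. v (1 - s)) d u" for u d
  proof (induction d arbitrary: u)
    case 0
    show ?case
    proof (induction u)
      case (Suc u)
      have "\<gamma> (- int u - 1) = \<gamma> (- 1 - int u)"
        by (rule arg_cong[of _ _ \<gamma>]) simp
      then show ?case using Suc \<gamma>[of "- int u"] by (simp add: mult_ac)
    qed (simp add: \<gamma>0)
  next
    case (Suc d)
    show ?case
    proof (induction u)
      case 0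
      show ?case using Suc[of 0] \<gamma>[of "int (Suc d)"] by simp
    next
      case (Suc u)
      define s where "s = int d - int u"
      have "path_sum v u (Suc d) = \<gamma> (s + 1) * path_sum (\<lambda>s. v (1 - s)) (Suc d) u"
        using Suc.IH by (simp add: s_def algebra_simps)
      moreover have "path_sum v (Suc u) d = \<gamma> (s - 1) * path_sum (\<lambda>s. v (1 - s)) d (Suc u)"
        using \<open>\<And>u. path_sum v u d = _\<close>[of "Suc u"] by (simp add: s_def algebra_simps)
      moreover have "\<gamma> (s + 1) = v (s + 1) * \<gamma> s" "\<gamma> s = v s * \<gamma> (s - 1)"
        using \<gamma>[of "s + 1"] \<gamma>[of s] by simp_all
      moreover have "int (Suc d) - int (Suc u) = s" "1 - (int u - int d) = s + 1"
        by (simp_all add: s_def)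
      ultimately show ?case
        unfolding path_sum.simps s_def[symmetric] by (simp only:) (simp only: algebra_simps)
    qed
  qed
  from this[of p p] show ?thesis by (simp add: \<gamma>0)
qed

text \<open>Centring at the midpoint \<open>s - 1/2\<close> of the edge makes the reflection
  \<open>s\<close> to \<open>1 - s\<close> the same as a change of sign of \<open>h\<close>.\<close>

definition edge_weight :: "real \<Rightarrow> real \<Rightarrow> int \<Rightarrow> real" where
  "edge_weight h z s = z * exp (- h * (of_int s - 1 / 2)) * (1 - z * exp (- h * (of_int s - 1 / 2)))"

text \<open>Polynomiality in \<open>z\<close> serves to extend an identity proved for
  \<open>z < 0\<close> to all \<open>z\<close>.\<close>

lemma path_sum_edge_weight_poly: "\<exists>r. \<forall>z. path_sum (edge_weight h z) u d = poly r z"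
proof -
  have e: "\<exists>r. \<forall>z. edge_weight h z s = poly r z" for s
    by (rule exI[of _ "[:0, exp (- h * (of_int s - 1 / 2)), - (exp (- h * (of_int s - 1 / 2)))\<^sup>2:]"])
      (simp add: edge_weight_def power2_eq_square algebra_simps)
  show ?thesis
  proof (induction d arbitrary: u)
    case 0
    show ?case by (auto intro: exI[of _ 1])
  next
    case (Suc d)
    show ?case
    proof (induction u)
      case 0
      from Suc[of 0] e[of "int (Suc d)"] show ?case
        by (simp only: path_sum.simps) (metis poly_mult)
    next
      case (Suc u)
      from Suc \<open>\<exists>r. \<forall>z. path_sum (edge_weight h z) (Suc u) d = poly r z\<close> e[of "int d - int u"]
      show ?case
        by (simp only: path_sum.simps) (metis poly_add poly_mult)
    qed
  qed
qed

text \<open>Reflection replaces \<open>h\<close> by \<open>- h\<close> but requires nonzero weights,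
  which can fail for \<open>z \<ge> 0\<close>. For \<open>z < 0\<close> all weights are negative,
  and two polynomials in \<open>z\<close> that agree there are equal.\<close>

lemma path_sum_edge_weight_even:
  "path_sum (edge_weight (- h) z) p p = path_sum (edge_weight h z) p p"
proof -
  obtain r r' where r: "\<And>z. path_sum (edge_weight h z) p p = poly r z"
      "\<And>z. path_sum (edge_weight (- h) z) p p = poly r' z"
    using path_sum_edge_weight_poly by metis
  have "poly r z = poly r' z" if "z < 0" for z
  proof -
    have "edge_weight h z s < 0" for s
    proof -
      have neg: "a * (1 - a) < 0" if "a < 0" for a :: real
        using that by (simp add: mult_neg_pos)
      show ?thesis
        unfolding edge_weight_def by (intro neg mult_neg_pos that exp_gt_zero)
    qed
    moreover have "edge_weight h z (1 - s) = edge_weight (- h) z s" for s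
      by (simp add: edge_weight_def algebra_simps)
    ultimately show ?thesis
      using path_sum_reflect[of "edge_weight h z" p] unfolding r[symmetric]
      by (metis (no_types, lifting) ext less_irrefl)
  qed
  then have "{..<0} \<subseteq> {z. poly (r - r') z = 0}" by auto
  then have "infinite {z. poly (r - r') z = 0}"
    using infinite_Iio[of "0::real"] finite_subset by blast
  then have "r - r' = 0"
    using poly_roots_finite by blast
  then show ?thesis by (simp add: r)
qed

section \<open>Expansions in \<open>h\<close> to fourth order, uniform in \<open>z\<close>\<close>

definition bounded_coeff :: "(real \<Rightarrow> real \<Rightarrow> real) \<Rightarrow> bool" where
  "bounded_coeff r \<longleftrightarrow> (\<exists>K. \<forall>h z. \<bar>h\<bar> \<le> 1 \<longrightarrow> 0 \<le> z \<longrightarrow> z \<le> 1 \<longrightarrow> \<bar>r h z\<bar> \<le> K)"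

lemma bounded_coeffI:
  "(\<And>h z. \<bar>h\<bar> \<le> 1 \<Longrightarrow> 0 \<le> z \<Longrightarrow> z \<le> 1 \<Longrightarrow> \<bar>r h z\<bar> \<le> K) \<Longrightarrow> bounded_coeff r"
  unfolding bounded_coeff_def by blast

lemma bounded_coeff_const [intro!]: "bounded_coeff (\<lambda>h z. c)"
  by (rule bounded_coeffI[of _ "\<bar>c\<bar>"]) simp

lemma bounded_coeff_vars [intro!]: "bounded_coeff (\<lambda>h z. h)" "bounded_coeff (\<lambda>h z. z)"
  by (rule bounded_coeffI[of _ 1]; simp)+

lemma bounded_coeff_add [intro!]:
  assumes "bounded_coeff r" "bounded_coeff r'"
  shows "bounded_coeff (\<lambda>h z. r h z + r' h z)"
proof -
  from assms obtain K K' where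
    "\<And>h z. \<bar>h\<bar> \<le> 1 \<Longrightarrow> 0 \<le> z \<Longrightarrow> z \<le> 1 \<Longrightarrow> \<bar>r h z\<bar> \<le> K"
    "\<And>h z. \<bar>h\<bar> \<le> 1 \<Longrightarrow> 0 \<le> z \<Longrightarrow> z \<le> 1 \<Longrightarrow> \<bar>r' h z\<bar> \<le> K'"
    unfolding bounded_coeff_def by blast
  then show ?thesis
    by (intro bounded_coeffI[of _ "K + K'"] order.trans[OF abs_triangle_ineq] add_mono)
qed

lemma bounded_coeff_mult [intro!]:
  assumes "bounded_coeff r" "bounded_coeff r'"
  shows "bounded_coeff (\<lambda>h z. r h z * r' h z)"
proof -
  from assms obtain K K' where K:
    "\<And>h z. \<bar>h\<bar> \<le> 1 \<Longrightarrow> 0 \<le> z \<Longrightarrow> z \<le> 1 \<Longrightarrow> \<bar>r h z\<bar> \<le> K"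
    "\<And>h z. \<bar>h\<bar> \<le> 1 \<Longrightarrow> 0 \<le> z \<Longrightarrow> z \<le> 1 \<Longrightarrow> \<bar>r' h z\<bar> \<le> K'"
    unfolding bounded_coeff_def by blast
  from K(1)[of 0 0] have "0 \<le> K" by simp
  with K show ?thesis
    by (intro bounded_coeffI[of _ "K * K'"]) (simp add: abs_mult mult_mono)
qed

lemma bounded_coeff_power [intro!]:
  "bounded_coeff r \<Longrightarrow> bounded_coeff (\<lambda>h z. r h z ^ n)"
  by (induction n) auto

text \<open>The cubic coefficient \<open>d\<close> stays anonymous because parity removes it in the
  end, but it has to be independent of \<open>h\<close>. Boundedness of all coefficients makes
  products of expansions expansions again.\<close>

definition has_expansion ::
    "(real \<Rightarrow> real \<Rightarrow> real) \<Rightarrow> (real \<Rightarrow> real) \<Rightarrow> (real \<Rightarrow> real) \<Rightarrow> (real \<Rightarrow> real) \<Rightarrow> bool" where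
  "has_expansion f a b c \<longleftrightarrow>
     bounded_coeff (\<lambda>h. a) \<and> bounded_coeff (\<lambda>h. b) \<and> bounded_coeff (\<lambda>h. c) \<and>
     (\<exists>d r. bounded_coeff (\<lambda>h. d) \<and> bounded_coeff r \<and>
       (\<forall>h z. \<bar>h\<bar> \<le> 1 \<longrightarrow> 0 \<le> z \<longrightarrow> z \<le> 1 \<longrightarrow>
          f h z = a z + b z * h + c z * h ^ 2 + d z * h ^ 3 + r h z * h ^ 4))"

lemma has_expansion_add:
  assumes "has_expansion f a b c" "has_expansion f' a' b' c'"
  shows "has_expansion (\<lambda>h z. f h z + f' h z) (\<lambda>z. a z + a' z) (\<lambda>z. b z + b' z) (\<lambda>z. c z + c' z)"
proof -
  from assms obtain d r d' r' where *:
    "bounded_coeff (\<lambda>h. a)" "bounded_coeff (\<lambda>h. b)" "bounded_coeff (\<lambda>h. c)"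
    "bounded_coeff (\<lambda>h. d)" "bounded_coeff r"
    "bounded_coeff (\<lambda>h. a')" "bounded_coeff (\<lambda>h. b')" "bounded_coeff (\<lambda>h. c')"
    "bounded_coeff (\<lambda>h. d')" "bounded_coeff r'"
    "\<And>h z. \<bar>h\<bar> \<le> 1 \<Longrightarrow> 0 \<le> z \<Longrightarrow> z \<le> 1 \<Longrightarrow>
       f h z = a z + b z * h + c z * h ^ 2 + d z * h ^ 3 + r h z * h ^ 4"
    "\<And>h z. \<bar>h\<bar> \<le> 1 \<Longrightarrow> 0 \<le> z \<Longrightarrow> z \<le> 1 \<Longrightarrow>
       f' h z = a' z + b' z * h + c' z * h ^ 2 + d' z * h ^ 3 + r' h z * h ^ 4"
    unfolding has_expansion_def by blast
  show ?thesis
    unfolding has_expansion_def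
    by (intro conjI exI[of _ "\<lambda>z. d z + d' z"] exI[of _ "\<lambda>h z. r h z + r' h z"]
        bounded_coeff_add * allI impI) (simp add: * algebra_simps)
qed

lemma has_expansion_mult:
  assumes "has_expansion f a b c" "has_expansion f' a' b' c'"
  shows "has_expansion (\<lambda>h z. f h z * f' h z) (\<lambda>z. a z * a' z)
    (\<lambda>z. a z * b' z + b z * a' z) (\<lambda>z. a z * c' z + b z * b' z + c z * a' z)"
proof -
  from assms obtain d r d' r' where *:
    "bounded_coeff (\<lambda>h. a)" "bounded_coeff (\<lambda>h. b)" "bounded_coeff (\<lambda>h. c)"
    "bounded_coeff (\<lambda>h. d)" "bounded_coeff r"
    "bounded_coeff (\<lambda>h. a')" "bounded_coeff (\<lambda>h. b')" "bounded_coeff (\<lambda>h. c')"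
    "bounded_coeff (\<lambda>h. d')" "bounded_coeff r'"
    "\<And>h z. \<bar>h\<bar> \<le> 1 \<Longrightarrow> 0 \<le> z \<Longrightarrow> z \<le> 1 \<Longrightarrow>
       f h z = a z + b z * h + c z * h ^ 2 + d z * h ^ 3 + r h z * h ^ 4"
    "\<And>h z. \<bar>h\<bar> \<le> 1 \<Longrightarrow> 0 \<le> z \<Longrightarrow> z \<le> 1 \<Longrightarrow>
       f' h z = a' z + b' z * h + c' z * h ^ 2 + d' z * h ^ 3 + r' h z * h ^ 4"
    unfolding has_expansion_def by blast
  \<comment> \<open>\<open>R\<close> collects the terms of order at least four in the
    product.\<close>
  define R where "R = (\<lambda>h z. (a z * r' h z + b z * d' z + c z * c' z + d z * b' z + r h z * a' z)
    + h * (b z * r' h z + c z * d' z + d z * c' z + r h z * b' z)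
    + h ^ 2 * (c z * r' h z + d z * d' z + r h z * c' z)
    + h ^ 3 * (d z * r' h z + r h z * d' z) + h ^ 4 * (r h z * r' h z))"
  have "bounded_coeff R"
    unfolding R_def by (intro bounded_coeff_add bounded_coeff_mult bounded_coeff_power bounded_coeff_vars *)
  moreover have "f h z * f' h z = a z * a' z + (a z * b' z + b z * a' z) * h +
      (a z * c' z + b z * b' z + c z * a' z) * h ^ 2 +
      (a z * d' z + b z * c' z + c z * b' z + d z * a' z) * h ^ 3 + R h z * h ^ 4"
    if "\<bar>h\<bar> \<le> 1" "0 \<le> z" "z \<le> 1" for h z
    unfolding *(11)[OF that] *(12)[OF that] R_def by algebra
  ultimately show ?thesis
    unfolding has_expansion_def
    by (intro conjI exI[of _ "\<lambda>z. a z * d' z + b z * c' z + c z * b' z + d z * a' z"] exI[of _ R]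
        bounded_coeff_add bounded_coeff_mult * allI impI) auto
qed

lemma has_expansion_of_z:
  "bounded_coeff (\<lambda>h. a) \<Longrightarrow> has_expansion (\<lambda>h. a) a (\<lambda>z. 0) (\<lambda>z. 0)"
  unfolding has_expansion_def by (auto intro!: exI[of _ "\<lambda>z. 0"] exI[of _ "\<lambda>h z. 0"])

lemma has_expansion_exp:
  "has_expansion (\<lambda>h z. exp (h * c)) (\<lambda>z. 1) (\<lambda>z. c) (\<lambda>z. c ^ 2 / 2)"
proof -
  \<comment> \<open>Lagrange remainder; its intermediate point has modulus at most
    \<open>\<bar>c\<bar>\<close> for \<open>\<bar>h\<bar> \<le> 1\<close>, which bounds it
    uniformly.\<close>
  have "\<exists>t. \<bar>t\<bar> \<le> \<bar>h * c\<bar> \<and> exp (h * c) = (\<Sum>m<4. (h * c) ^ m / fact m) + exp t / fact 4 * (h * c) ^ 4" for h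
    using Maclaurin_exp_le[of "h * c" 4] by simp
  then obtain t where t: "\<And>h. \<bar>t h\<bar> \<le> \<bar>h * c\<bar>"
      "\<And>h. exp (h * c) = (\<Sum>m<4. (h * c) ^ m / fact m) + exp (t h) / fact 4 * (h * c) ^ 4"
    by metis
  have "bounded_coeff (\<lambda>h z. exp (t h) / fact 4 * c ^ 4)"
  proof (rule bounded_coeffI)
    fix h :: real assume "\<bar>h\<bar> \<le> 1"
    then have "\<bar>h * c\<bar> \<le> \<bar>c\<bar>"
      using mult_right_mono[of "\<bar>h\<bar>" 1 "\<bar>c\<bar>"] by (simp add: abs_mult)
    then have "t h \<le> \<bar>c\<bar>"
      using t(1)[of h] by linarith
    then show "\<bar>exp (t h) / fact 4 * c ^ 4\<bar> \<le> exp \<bar>c\<bar> / fact 4 * \<bar>c ^ 4\<bar>"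
      unfolding abs_mult by (intro mult_right_mono) (auto intro: divide_right_mono)
  qed
  moreover have "exp (h * c) = 1 + c * h + c ^ 2 / 2 * h ^ 2 + c ^ 3 / 6 * h ^ 3 + exp (t h) / fact 4 * c ^ 4 * h ^ 4" for h
    by (subst t(2)) (simp add: numeral_eq_Suc algebra_simps)
  ultimately show ?thesis
    unfolding has_expansion_def
    by (intro conjI exI[of _ "\<lambda>z. c ^ 3 / 6"] exI[of _ "\<lambda>h z. exp (t h) / fact 4 * c ^ 4"]) blast+
qed

lemma has_expansion_edge_weight:
  fixes s :: int
  defines "\<sigma> \<equiv> of_int s - 1 / 2"
  shows "has_expansion (\<lambda>h z. edge_weight h z s) (\<lambda>z. z - z ^ 2)
    (\<lambda>z. - \<sigma> * (z - 2 * z ^ 2)) (\<lambda>z. \<sigma> ^ 2 / 2 * (z - 4 * z ^ 2))"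
proof -
  have "bounded_coeff (\<lambda>h z. - (z ^ 2))"
    by (rule bounded_coeffI[of _ 1]) (simp add: power_le_one)
  then have "has_expansion (\<lambda>h z. z * exp (h * (- \<sigma>)) + - (z ^ 2) * exp (h * (- 2 * \<sigma>)))
    (\<lambda>z. z * 1 + - (z ^ 2) * 1)
    (\<lambda>z. (z * - \<sigma> + 0 * 1) + (- (z ^ 2) * (- 2 * \<sigma>) + 0 * 1))
    (\<lambda>z. (z * ((- \<sigma>) ^ 2 / 2) + 0 * (- \<sigma>) + 0 * 1)
      + (- (z ^ 2) * ((- 2 * \<sigma>) ^ 2 / 2) + 0 * (- 2 * \<sigma>) + 0 * 1))"
    by (intro has_expansion_add has_expansion_mult has_expansion_exp has_expansion_of_z)
      auto
  moreover have "z * exp (h * (- \<sigma>)) + - (z ^ 2) * exp (h * (- 2 * \<sigma>)) = edge_weight h z s" for h z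
    by (simp add: edge_weight_def \<sigma>_def algebra_simps power2_eq_square flip: exp_add)
  ultimately show ?thesis
    by (simp add: algebra_simps power2_eq_square)
qed

text \<open>The numbers \<open>e1\<close>, \<open>e2\<close>, \<open>e11\<close> are the averages over all paths of \<open>\<Sum> \<sigma>\<close>,
  \<open>\<Sum> \<sigma>\<^sup>2\<close> and \<open>(\<Sum> \<sigma>)\<^sup>2\<close>, where \<open>\<sigma>\<close> runs through the midpoints of the down-steps of the path.\<close>

definition e1 :: "nat \<Rightarrow> nat \<Rightarrow> real" where
  "e1 u d = d * (real d - u) / 2"

definition e2 :: "nat \<Rightarrow> nat \<Rightarrow> real" where
  "e2 u d = d * (4 * (real d - u) ^ 2 - 1 + 4 * u) / 12"

definition e11 :: "nat \<Rightarrow> nat \<Rightarrow> real" where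
  "e11 u d = (d * (real d - u)) ^ 2 / 4 + real u * d * (u + d + 1) / 12"

definition path_coeff0 :: "nat \<Rightarrow> nat \<Rightarrow> real \<Rightarrow> real" where
  "path_coeff0 u d z = real ((u + d) choose d) * (z - z ^ 2) ^ d"

definition path_coeff1 :: "nat \<Rightarrow> nat \<Rightarrow> real \<Rightarrow> real" where
  "path_coeff1 u d z = - (real ((u + d) choose d) * e1 u d * (z - 2 * z ^ 2) * (z - z ^ 2) ^ (d - 1))"

text \<open>At order \<open>h^2\<close> one edge of a path contributes
  \<open>\<sigma>^2 / 2\<close>, and the pairs of distinct edges contribute
  \<open>((\<Sum> \<sigma>)^2 - \<Sum> \<sigma>^2) / 2\<close> in total; averaging gives
  \<open>e2\<close> and \<open>e11 - e2\<close>. The truncated exponent \<open>d - 2\<close> is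
  harmless at \<open>d = 1\<close> because \<open>e11 u 1 = e2 u 1\<close>.\<close>

definition path_coeff2 :: "nat \<Rightarrow> nat \<Rightarrow> real \<Rightarrow> real" where
  "path_coeff2 u d z = real ((u + d) choose d) / 2 *
     (e2 u d * (z - 4 * z ^ 2) * (z - z ^ 2) ^ (d - 1) +
      (e11 u d - e2 u d) * (z - 2 * z ^ 2) ^ 2 * (z - z ^ 2) ^ (d - 2))"

text \<open>One common unit \<open>w\<close> for the three binomials in Pascal's rule turns the
  recursion of the path coefficients into polynomial identities.\<close>

lemma binomial_neighbours:
  obtains w :: real where
    "((u + Suc d) choose (Suc d)) = real (Suc u) * w"
    "((Suc u + d) choose d) = real (Suc d) * w"
    "((Suc u + Suc d) choose (Suc d)) = (real (Suc u) + real (Suc d)) * w"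
proof -
  define w where "w = real ((Suc u + d) choose d) / real (Suc d)"
  have "Suc d * ((u + Suc d) choose (Suc d)) = Suc u * ((Suc u + d) choose d)"
    using Suc_times_binomial_add[of d u] by (simp add: add_ac)
  then have "real (Suc d) * real ((u + Suc d) choose (Suc d)) = real (Suc u) * real ((Suc u + d) choose d)"
    by (metis of_nat_mult)
  then have w: "((u + Suc d) choose (Suc d)) = real (Suc u) * w" "((Suc u + d) choose d) = real (Suc d) * w"
    by (simp_all add: w_def field_simps del: of_nat_Suc)
  moreover have "((Suc u + Suc d) choose (Suc d)) = ((Suc u + d) choose d) + ((u + Suc d) choose (Suc d))"
    by simp
  ultimately show ?thesis
    using that[of w] by (metis add.commute distrib_right of_nat_add)
qed

lemma path_coeff_0 [simp]:
  "path_coeff0 u 0 z = 1" "path_coeff1 u 0 z = 0" "path_coeff2 u 0 z = 0"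
  by (simp_all add: path_coeff0_def path_coeff1_def path_coeff2_def e1_def e2_def e11_def)

lemma path_coeff_0_Suc:
  fixes z :: real and d :: nat
  defines "\<sigma> \<equiv> d + 1 / 2"
  shows "path_coeff0 0 (Suc d) z = (z - z ^ 2) * path_coeff0 0 d z"
    and "path_coeff1 0 (Suc d) z =
      (z - z ^ 2) * path_coeff1 0 d z + - \<sigma> * (z - 2 * z ^ 2) * path_coeff0 0 d z"
    and "path_coeff2 0 (Suc d) z = (z - z ^ 2) * path_coeff2 0 d z +
      - \<sigma> * (z - 2 * z ^ 2) * path_coeff1 0 d z + \<sigma> ^ 2 / 2 * (z - 4 * z ^ 2) * path_coeff0 0 d z"
proof -
  define g g1 g2 where g: "g = z - z ^ 2" "g1 = z - 2 * z ^ 2" "g2 = z - 4 * z ^ 2"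
  note defs = path_coeff0_def path_coeff1_def path_coeff2_def e1_def e2_def e11_def \<sigma>_def g[symmetric]
  show "path_coeff0 0 (Suc d) z = (z - z ^ 2) * path_coeff0 0 d z"
    by (simp add: defs)
  consider "d = 0" | "d = 1" | n where "d = Suc (Suc n)"
    by (metis One_nat_def not0_implies_Suc)
  note cs = this
  show "path_coeff1 0 (Suc d) z =
      (z - z ^ 2) * path_coeff1 0 d z + - \<sigma> * (z - 2 * z ^ 2) * path_coeff0 0 d z"
    by (rule cs) (simp_all add: defs field_simps)
  show "path_coeff2 0 (Suc d) z = (z - z ^ 2) * path_coeff2 0 d z +
      - \<sigma> * (z - 2 * z ^ 2) * path_coeff1 0 d z + \<sigma> ^ 2 / 2 * (z - 4 * z ^ 2) * path_coeff0 0 d z"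
    by (rule cs) (simp_all add: defs field_simps power2_eq_square)
qed

text \<open>This is the first-step recursion of \<open>path_sum\<close>, read off order by order in
  \<open>h\<close>; it verifies the closed forms of the averages. Small \<open>d\<close> is treated
  separately because the exponents \<open>d - 1\<close> and \<open>d - 2\<close> truncate.\<close>

lemma path_coeff_Suc_Suc:
  fixes z :: real and u d :: nat
  defines "\<sigma> \<equiv> real d - real u - 1 / 2"
  shows "path_coeff0 (Suc u) (Suc d) z = path_coeff0 u (Suc d) z + (z - z ^ 2) * path_coeff0 (Suc u) d z"
    and "path_coeff1 (Suc u) (Suc d) z = path_coeff1 u (Suc d) z +
      ((z - z ^ 2) * path_coeff1 (Suc u) d z + - \<sigma> * (z - 2 * z ^ 2) * path_coeff0 (Suc u) d z)"
    and "path_coeff2 (Suc u) (Suc d) z = path_coeff2 u (Suc d) z +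
      ((z - z ^ 2) * path_coeff2 (Suc u) d z +
      - \<sigma> * (z - 2 * z ^ 2) * path_coeff1 (Suc u) d z + \<sigma> ^ 2 / 2 * (z - 4 * z ^ 2) * path_coeff0 (Suc u) d z)"
proof -
  define g g1 g2 where g: "g = z - z ^ 2" "g1 = z - 2 * z ^ 2" "g2 = z - 4 * z ^ 2"
  obtain w :: real where w:
    "((u + Suc d) choose (Suc d)) = real (Suc u) * w"
    "((Suc u + d) choose d) = real (Suc d) * w"
    "((Suc u + Suc d) choose (Suc d)) = (real (Suc u) + real (Suc d)) * w"
    by (rule binomial_neighbours)
  note defs = path_coeff0_def path_coeff1_def path_coeff2_def w e1_def e2_def e11_def \<sigma>_def g[symmetric]
  consider "d = 0" | "d = 1" | n where "d = Suc (Suc n)"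
    by (metis One_nat_def not0_implies_Suc)
  note cs = this
  show "path_coeff0 (Suc u) (Suc d) z = path_coeff0 u (Suc d) z + (z - z ^ 2) * path_coeff0 (Suc u) d z"
    unfolding defs by (simp add: algebra_simps)
  show "path_coeff1 (Suc u) (Suc d) z = path_coeff1 u (Suc d) z +
      ((z - z ^ 2) * path_coeff1 (Suc u) d z + - \<sigma> * (z - 2 * z ^ 2) * path_coeff0 (Suc u) d z)"
    unfolding defs by (rule cs) (simp_all add: field_simps)
  show "path_coeff2 (Suc u) (Suc d) z = path_coeff2 u (Suc d) z +
      ((z - z ^ 2) * path_coeff2 (Suc u) d z +
      - \<sigma> * (z - 2 * z ^ 2) * path_coeff1 (Suc u) d z + \<sigma> ^ 2 / 2 * (z - 4 * z ^ 2) * path_coeff0 (Suc u) d z)"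
    unfolding defs by (rule cs) (simp_all add: field_simps power2_eq_square)
qed

lemma has_expansion_path_sum:
  "has_expansion (\<lambda>h z. path_sum (edge_weight h z) u d)
     (path_coeff0 u d) (path_coeff1 u d) (path_coeff2 u d)"
proof (induction d arbitrary: u)
  case 0
  have "path_coeff0 u 0 = (\<lambda>z. 1)" "path_coeff1 u 0 = (\<lambda>z. 0)" "path_coeff2 u 0 = (\<lambda>z. 0)"
    by (simp_all add: fun_eq_iff)
  then show ?case
    using has_expansion_of_z[of "\<lambda>z. 1"] by auto
next
  case (Suc d)
  show ?case
  proof (induction u)
    case 0
    have *: "of_int (int (Suc d)) - 1 / 2 = d + (1 / 2 :: real)" by simp
    show ?case
      unfolding path_sum.simps path_coeff_0_Suc[abs_def]
      using has_expansion_mult[OF has_expansion_edge_weight[of "int (Suc d)"] Suc[of 0]]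
      unfolding * by (simp add: algebra_simps)
  next
    case (Suc u)
    have *: "of_int (int d - int u) - 1 / 2 = real d - real u - 1 / 2" by simp
    show ?case
      unfolding path_sum.simps path_coeff_Suc_Suc[abs_def]
      using has_expansion_add[OF Suc has_expansion_mult[OF has_expansion_edge_weight[of "int d - int u"]
        \<open>has_expansion _ (path_coeff0 (Suc u) d) _ _\<close>]]
      unfolding * by (simp add: algebra_simps)
  qed
qed

text \<open>By parity the path sum is the mean of its expansions at \<open>h\<close> and
  \<open>- h\<close>, in which all odd orders cancel, including the unspecified cubic one.\<close>

lemma path_sum_edge_weight_expansion:
  obtains K where "\<And>h z. \<bar>h\<bar> \<le> 1 \<Longrightarrow> 0 \<le> z \<Longrightarrow> z \<le> 1 \<Longrightarrow>
    \<bar>path_sum (edge_weight h z) p p - (path_coeff0 p p z + path_coeff2 p p z * h ^ 2)\<bar> \<le> K * h ^ 4"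
proof -
  obtain d r where "bounded_coeff r" and e: "\<And>h z. \<bar>h\<bar> \<le> 1 \<Longrightarrow> 0 \<le> z \<Longrightarrow> z \<le> 1 \<Longrightarrow>
      path_sum (edge_weight h z) p p = path_coeff0 p p z + path_coeff1 p p z * h +
        path_coeff2 p p z * h ^ 2 + d z * h ^ 3 + r h z * h ^ 4"
    using has_expansion_path_sum[of p p] unfolding has_expansion_def by blast
  then obtain K where K: "\<And>h z. \<bar>h\<bar> \<le> 1 \<Longrightarrow> 0 \<le> z \<Longrightarrow> z \<le> 1 \<Longrightarrow> \<bar>r h z\<bar> \<le> K"
    unfolding bounded_coeff_def by blast
  show ?thesis
  proof (rule that)
    fix h z :: real assume *: "\<bar>h\<bar> \<le> 1" "0 \<le> z" "z \<le> 1"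
    have "2 * path_sum (edge_weight h z) p p =
        path_sum (edge_weight h z) p p + path_sum (edge_weight (- h) z) p p"
      by (simp add: path_sum_edge_weight_even)
    also have "\<dots> = 2 * (path_coeff0 p p z + path_coeff2 p p z * h ^ 2) + (r h z + r (- h) z) * h ^ 4"
      using e[OF *] e[of "- h" z] * by (simp add: algebra_simps)
    finally have eq: "path_sum (edge_weight h z) p p - (path_coeff0 p p z + path_coeff2 p p z * h ^ 2) =
        (r h z + r (- h) z) / 2 * h ^ 4"
      by simp
    have "\<bar>(r h z + r (- h) z) / 2\<bar> \<le> K"
      using K[OF *] K[of "- h" z] * by (simp add: abs_le_iff)
    then show "\<bar>path_sum (edge_weight h z) p p - (path_coeff0 p p z + path_coeff2 p p z * h ^ 2)\<bar> \<le> K * h ^ 4"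
      unfolding eq abs_mult by (intro mult_mono) auto
  qed
qed

section \<open>Midpoint sums\<close>

text \<open>The geometric series sums to \<open>(1 - exp(-c)) / (2 sinh(y / 2))\<close> with
  \<open>c = k lam\<close> and \<open>y = c / N\<close>, and
  \<open>1 / (2 sinh(y / 2)) = 1/y - y/24 + O(y^3)\<close>.\<close>

lemma midpoint_sum_monom:
  fixes lam :: real and k :: nat
  assumes lam: "lam > 0" and k: "k \<ge> 1"
  shows "(\<lambda>N. (\<Sum>j<N. exp (- (real j + 1 / 2) * (lam / real N)) ^ k) -
      ((1 - exp (- lam) ^ k) / real k * (real N / lam)
        - lam / (24 * real N) * (real k * (1 - exp (- lam) ^ k))))
    \<in> O(\<lambda>N. 1 / real N ^ 3)"
proof -
  define c where "c = real k * lam"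
  have c: "c > 0" using assms by (simp add: c_def)
  have "(\<lambda>N::nat. exp (- c / (2 * real N)) / (1 - exp (- c / real N)) -
      (real N / c - c / (24 * real N))) \<in> O(\<lambda>N. 1 / real N ^ 3)"
  proof -
    have "(\<lambda>x::real. exp (- 1 / (2 * x)) / (1 - exp (- 1 / x)) - (x - 1 / (24 * x))) \<in> O(\<lambda>x. 1 / x ^ 3)"
      by real_asymp
    moreover have "filterlim (\<lambda>N. real N / c) at_top sequentially"
      using c by real_asymp
    ultimately have "(\<lambda>N. exp (- 1 / (2 * (real N / c))) / (1 - exp (- 1 / (real N / c))) -
        (real N / c - 1 / (24 * (real N / c)))) \<in> O(\<lambda>N. 1 / (real N / c) ^ 3)"
      by (rule landau_o.big.compose)
    also have "(\<lambda>N. 1 / (real N / c) ^ 3) = (\<lambda>N. c ^ 3 * (1 / real N ^ 3))"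
      by (simp add: power_divide)
    also have "O(\<lambda>N. c ^ 3 * (1 / real N ^ 3)) = O(\<lambda>N. 1 / real N ^ 3)"
      using c by (intro landau_o.big.cmult) auto
    finally show ?thesis
      using c by simp
  qed
  then have "(\<lambda>N::nat. (1 - exp (- c)) * (exp (- c / (2 * real N)) / (1 - exp (- c / real N)) -
      (real N / c - c / (24 * real N)))) \<in> O(\<lambda>N. 1 / real N ^ 3)"
    by simp
  moreover have "\<forall>\<^sub>F N in sequentially.
      (1 - exp (- c)) * (exp (- c / (2 * real N)) / (1 - exp (- c / real N)) -
        (real N / c - c / (24 * real N))) =
      (\<Sum>j<N. exp (- (real j + 1 / 2) * (lam / real N)) ^ k) -
      ((1 - exp (- lam) ^ k) / real k * (real N / lam)
        - lam / (24 * real N) * (real k * (1 - exp (- lam) ^ k)))"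
    using eventually_gt_at_top[of 0]
  proof eventually_elim
    case (elim N)
    define y where "y = exp (- c / real N)"
    have y: "y \<noteq> 1" using c elim by (simp add: y_def)
    have "(\<Sum>j<N. exp (- (real j + 1 / 2) * (lam / real N)) ^ k) =
        (\<Sum>j<N. exp (- c / (2 * real N)) * y ^ j)"
      unfolding y_def c_def exp_of_nat_mult [symmetric] exp_add [symmetric]
      by (intro sum.cong refl arg_cong[of _ _ exp]) (use elim in \<open>simp add: field_simps\<close>)
    also have "\<dots> = exp (- c / (2 * real N)) * ((1 - y ^ N) / (1 - y))"
      using y by (simp add: sum_distrib_left [symmetric] sum_gp_strict)
    also have "y ^ N = exp (- c)"
      unfolding y_def exp_of_nat_mult [symmetric] using elim by simp
    finally have 1: "(\<Sum>j<N. exp (- (real j + 1 / 2) * (lam / real N)) ^ k) =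
        (1 - exp (- c)) * (exp (- c / (2 * real N)) / (1 - exp (- c / real N)))"
      by (simp add: y_def)
    have 2: "exp (- lam) ^ k = exp (- c)"
      by (simp add: c_def exp_of_nat_mult [symmetric])
    show ?case
      unfolding 1 2 using assms elim by (simp add: c_def field_simps)
  qed
  ultimately show ?thesis
    by (rule landau_o.big.in_cong[THEN iffD1, rotated])
qed

section \<open>The midpoint rule for polynomials\<close>

definition euler_op :: "real poly \<Rightarrow> real poly" where
  "euler_op p = [:0, 1:] * pderiv p"

lemma euler_op_add: "euler_op (p + r) = euler_op p + euler_op r"
  by (simp add: euler_op_def pderiv_add)

lemma euler_op_0 [simp]: "euler_op 0 = 0"
  by (simp add: euler_op_def)

lemma euler_op_monom: "euler_op (monom c k) = monom (real k * c) k"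
  by (cases k) (simp_all add: euler_op_def pderiv_monom flip: monom_Suc)

lemma euler_op_smult: "euler_op (smult c p) = smult c (euler_op p)"
  by (simp add: euler_op_def pderiv_smult)

text \<open>With \<open>z = exp(-t)\<close>, \<open>euler_op\<close> is \<open>- d/dt\<close>. This
  is therefore the midpoint rule on \<open>[0, lam]\<close> with step \<open>lam / N\<close>:
  \<open>G\<close> integrates \<open>euler_op G\<close>, and the next application of
  \<open>euler_op\<close> yields the boundary correction. By linearity monomials suffice.\<close>

lemma midpoint_sum_poly:
  fixes lam :: real and G :: "real poly"
  assumes lam: "lam > 0"
  shows "(\<lambda>N. (\<Sum>j<N. poly (euler_op G) (exp (- (real j + 1 / 2) * (lam / real N)))) -
      ((poly G 1 - poly G (exp (- lam))) * (real N / lam)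
        - lam / (24 * real N) *
          (poly (euler_op (euler_op G)) 1 - poly (euler_op (euler_op G)) (exp (- lam)))))
    \<in> O(\<lambda>N. 1 / real N ^ 3)" (is "?P G")
proof -
  have monom: "?P (monom c k)" for c k
  proof (cases "k = 0 \<or> c = 0")
    case True
    then show ?thesis by (auto simp: euler_op_monom poly_monom)
  next
    case False
    then have "(\<lambda>N. real k * c * ((\<Sum>j<N. exp (- (real j + 1 / 2) * (lam / real N)) ^ k) -
      ((1 - exp (- lam) ^ k) / real k * (real N / lam)
        - lam / (24 * real N) * (real k * (1 - exp (- lam) ^ k))))) \<in> O(\<lambda>N. 1 / real N ^ 3)"
      using midpoint_sum_monom[OF lam, of k] by (intro landau_o.big.cmult_in_iff[THEN iffD2]) auto
    also have "(\<lambda>N. real k * c * ((\<Sum>j<N. exp (- (real j + 1 / 2) * (lam / real N)) ^ k) -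
      ((1 - exp (- lam) ^ k) / real k * (real N / lam)
        - lam / (24 * real N) * (real k * (1 - exp (- lam) ^ k))))) =
      (\<lambda>N. (\<Sum>j<N. poly (euler_op (monom c k)) (exp (- (real j + 1 / 2) * (lam / real N)))) -
      ((poly (monom c k) 1 - poly (monom c k) (exp (- lam))) * (real N / lam)
        - lam / (24 * real N) *
          (poly (euler_op (euler_op (monom c k))) 1 - poly (euler_op (euler_op (monom c k))) (exp (- lam)))))"
      unfolding euler_op_monom poly_monom sum_distrib_left [symmetric]
    proof
      fix N
      show "real k * c * ((\<Sum>j<N. exp (- (real j + 1 / 2) * (lam / real N)) ^ k) -
        ((1 - exp (- lam) ^ k) / real k * (real N / lam)
          - lam / (24 * real N) * (real k * (1 - exp (- lam) ^ k)))) =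
        real k * c * (\<Sum>j<N. exp (- (real j + 1 / 2) * (lam / real N)) ^ k) -
        ((c * 1 ^ k - c * exp (- lam) ^ k) * (real N / lam)
          - lam / (24 * real N) * (real k * (real k * c) * 1 ^ k - real k * (real k * c) * exp (- lam) ^ k))"
        using False lam by (cases "N = 0") (simp_all add: field_simps)
    qed
    finally show ?thesis .
  qed
  have add: "?P (p + r)" if "?P p" "?P r" for p r
    using sum_in_bigo(1)[OF that]
    by (rule back_subst[of "\<lambda>f. f \<in> _"])
      (auto simp: fun_eq_iff euler_op_add sum.distrib algebra_simps add_divide_distrib diff_divide_distrib)
  have "?P (\<Sum>i\<in>A. monom (coeff G i) i)" if "finite A" for A
    using that
  proof (induction A rule: finite_induct)
    case empty
    show ?case by simp
  next
    case (insert i A)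
    show ?case
      unfolding sum.insert[OF insert.hyps] by (rule add[OF monom insert.IH])
  qed
  from this[of "{..degree G}"] show ?thesis
    by (simp add: poly_as_sum_of_monoms)
qed

lemma poly_antiderivative:
  fixes P :: "real poly"
  obtains G where "pderiv G = P"
proof
  show "pderiv (\<Sum>i\<le>degree P. monom (coeff P i / real (Suc i)) (Suc i)) = P"
    by (subst (3) poly_as_sum_of_monoms [symmetric])
      (simp add: higher_pderiv_sum[of 1, simplified] pderiv_monom del: of_nat_Suc)
qed

text \<open>The substitution \<open>t = 1 - z\<close> turns the beta integrand into
  \<open>z^(p-1) (1 - z)^p\<close>, and the Gamma quotient equals
  \<open>(2p)! / (p! (p-1)!)\<close>, which is \<open>p\<close> times the central binomial
  coefficient.\<close>

lemma reg_inc_beta_poly: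
  fixes x :: real and p :: nat
  assumes "0 < x" "x \<le> 1" "p \<ge> 1"
  assumes G: "pderiv G = smult (real ((2 * p) choose p)) ([:0, 1:] ^ (p - 1) * [:1, - 1:] ^ p)"
  shows "reg_inc_beta (1 - x) (real p + 1) (real p) = real p * (poly G 1 - poly G x)"
proof -
  define C where "C = real ((2 * p) choose p)"
  have C: "C > 0" by (simp add: C_def)
  have "((\<lambda>t. C * (t ^ p * (1 - t) ^ (p - 1))) has_integral (- poly G (1 - (1 - x)) - - poly G (1 - 0))) {0..1 - x}"
  proof (rule fundamental_theorem_of_calculus)
    show "0 \<le> 1 - x" using assms by simp
    fix t
    have "((\<lambda>t. - poly G (1 - t)) has_real_derivative poly (pderiv G) (1 - t)) (at t within {0..1 - x})"
      by (auto intro!: derivative_eq_intros DERIV_chain'[OF _ poly_DERIV])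
    moreover have "poly (pderiv G) (1 - t) = C * (t ^ p * (1 - t) ^ (p - 1))"
      by (simp add: G C_def poly_power mult_ac)
    ultimately show "((\<lambda>t. - poly G (1 - t)) has_vector_derivative C * (t ^ p * (1 - t) ^ (p - 1))) (at t within {0..1 - x})"
      by (simp add: has_real_derivative_iff_has_vector_derivative)
  qed
  from has_integral_mult_right[OF this, of "1 / C"]
  have "((\<lambda>t. t ^ p * (1 - t) ^ (p - 1)) has_integral (poly G 1 - poly G x) / C) {0..1 - x}"
    using C by simp
  then have "((\<lambda>t. t powr (real p + 1 - 1) * (1 - t) powr (real p - 1)) has_integral (poly G 1 - poly G x) / C) {0..1 - x}"
  proof (rule has_integral_eq[rotated])
    fix t assume t: "t \<in> {0..1 - x}"
    have "t powr (real p + 1 - 1) = t ^ p"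
      using t assms(3) by (cases "t = 0") (auto simp: powr_realpow)
    \<comment> \<open>Here \<open>x > 0\<close> keeps \<open>1 - t\<close> positive, which matters
      for \<open>p = 1\<close> because \<open>0 powr 0 = 0\<close>.\<close>
    moreover have "(1 - t) powr (real p - 1) = (1 - t) ^ (p - 1)"
      using t assms powr_realpow[of "1 - t" "p - 1"] by (simp add: of_nat_diff)
    ultimately show "t ^ p * (1 - t) ^ (p - 1) = t powr (real p + 1 - 1) * (1 - t) powr (real p - 1)"
      by simp
  qed
  moreover have "Gamma (real p + 1 + real p) / (Gamma (real p + 1) * Gamma (real p)) = real p * C"
  proof -
    obtain r where p: "p = Suc r" using assms(3) by (cases p) auto
    have fp: "fact p = real p * fact r" by (simp add: p)
    have Gam: "Gamma (real p + 1) = fact p" "Gamma (real p) = fact r" "Gamma (real p + 1 + real p) = fact (2 * p)"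
      using Gamma_fact[of p, where 'a = real] Gamma_fact[of r, where 'a = real] Gamma_fact[of "2 * p", where 'a = real]
      by (simp_all add: p algebra_simps)
    have "C = fact (2 * p) / (fact p * fact p)"
      by (simp add: C_def binomial_fact)
    then show ?thesis
      unfolding Gam using assms(3) by (simp only: fp) (simp add: divide_simps)
  qed
  ultimately show ?thesis
    unfolding reg_inc_beta_def using C by (simp add: integral_unique)
qed

section \<open>The expansion of the moments\<close>

text \<open>The polynomial \<open>G2\<close> is read off from the claimed \<open>\<M>\<^sub>2\<^sub>p\<^sub>,\<^sub>1\<close>; its first summand cancels the
  correction term of the midpoint rule for \<open>G\<close>.\<close>

lemma path_coeff2_poly:
  fixes p :: nat and G :: "real poly"
  assumes p: "p \<ge> 1"
  defines "C \<equiv> real ((2 * p) choose p)"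
  assumes G: "pderiv G = smult C ([:0, 1:] ^ (p - 1) * [:1, - 1:] ^ p)"
  defines "T \<equiv> [:0, 1:] ^ p * [:1, - 1:] ^ (p - 1) * [:2 + real p, - (2 * real p + 1):]"
  defines "G2 \<equiv> smult (1 / 24) (euler_op (euler_op G)) - smult (real p ^ 2 / 6) G + smult (real p * C / 12) T"
  shows "poly (euler_op G) z = path_coeff0 p p z" "poly (euler_op G2) z = path_coeff2 p p z"
proof -
  have X: "euler_op G = smult C ([:0, 1:] ^ p * [:1, - 1:] ^ p)"
    unfolding euler_op_def G using p by (cases p) simp_all
  show Q0: "poly (euler_op G) z = path_coeff0 p p z"
    unfolding X path_coeff0_def C_def
    by (simp add: poly_power mult_2 mult_2_right power2_eq_square algebra_simps flip: power_mult_distrib)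
  have prod: "euler_op (P * R) = euler_op P * R + P * euler_op R" for P R
    by (simp add: euler_op_def pderiv_mult algebra_simps)
  have lin: "euler_op [:a, b:] = [:0, b:]" for a b
    by (simp add: euler_op_def pderiv_pCons)
  have pw: "euler_op (P ^ Suc n) = smult (real (Suc n)) (P ^ n * euler_op P)" for P n
    by (simp add: euler_op_def pderiv_power_Suc mult_ac del: power_Suc of_nat_Suc)
  have diff: "euler_op (P - R) = euler_op P - euler_op R" for P R
    by (simp add: euler_op_def pderiv_diff algebra_simps)
  have ct: "euler_op G2 = smult (1 / 24) (euler_op (euler_op (euler_op G))) - smult (real p ^ 2 / 6) (euler_op G)
      + smult (real p * C / 12) (euler_op T)"
    by (simp only: G2_def euler_op_add diff euler_op_smult)
  \<comment> \<open>The exponent \<open>p - 2\<close> truncates at \<open>p = 1\<close>. For larger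
    \<open>p\<close> all exponents become shifts of \<open>n\<close>, and a polynomial identity
    remains.\<close>
  consider "p = 1" | n where "p = Suc (Suc n)"
    using p by (metis One_nat_def Suc_le_D not0_implies_Suc)
  then show "poly (euler_op G2) z = path_coeff2 p p z"
  proof cases
    case 1
    then show ?thesis
      unfolding ct X T_def
      by (simp add: euler_op_def pderiv_pCons pderiv_mult pderiv_smult path_coeff2_def C_def e2_def e11_def
          power2_eq_square field_simps)
  next
    case (2 n)
    have C2: "((p + p) choose p) = C" by (simp add: C_def mult_2)
    have gz: "z - z ^ 2 = z * (1 - z)"
      by (simp add: algebra_simps power2_eq_square)
    have pp: "p - 1 = Suc n" "p - 2 = n" "p = Suc (Suc n)"
      using 2 by simp_all
    show ?thesis
      unfolding ct X T_def path_coeff2_def C2 gz e2_def e11_def unfolding pp(1,2) unfolding pp(3)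
      by (simp only: prod pw lin euler_op_smult euler_op_add poly_mult poly_add poly_diff poly_smult
          poly_power poly_pCons poly_0 power_mult_distrib,
          simp only: power_Suc power2_eq_square of_nat_Suc of_nat_add of_nat_mult)
        (simp add: field_simps)
  qed
qed

text \<open>Since \<open>reg_inc_beta\<close> is \<open>p\<close> times the difference of
  \<open>G\<close>, the summand \<open>- p^2 / 6\<close> times \<open>G\<close> yields the beta term
  of \<open>M_coeff1\<close>. The summand with \<open>T\<close> yields the elementary term through
  the value at \<open>exp (- lam)\<close> alone, as \<open>T\<close> vanishes at 1.\<close>

lemma M_coeff_poly:
  fixes lam :: real and p :: nat and G :: "real poly"
  assumes lam: "lam > 0" and p: "p \<ge> 1"
  defines "C \<equiv> real ((2 * p) choose p)"
  assumes G: "pderiv G = smult C ([:0, 1:] ^ (p - 1) * [:1, - 1:] ^ p)"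
  defines "T \<equiv> [:0, 1:] ^ p * [:1, - 1:] ^ (p - 1) * [:2 + real p, - (2 * real p + 1):]"
  defines "G2 \<equiv> smult (1 / 24) (euler_op (euler_op G)) - smult (real p ^ 2 / 6) G + smult (real p * C / 12) T"
  shows "M_coeff0 lam p = (poly G 1 - poly G (exp (- lam))) / lam"
    and "M_coeff1 lam p = lam * (poly G2 1 - poly G2 (exp (- lam)))
      - lam / 24 * (poly (euler_op (euler_op G)) 1 - poly (euler_op (euler_op G)) (exp (- lam)))"
proof -
  define x where "x = exp (- lam)"
  have I: "reg_inc_beta (1 - x) (real p + 1) (real p) = real p * (poly G 1 - poly G x)"
    unfolding x_def using lam p G unfolding C_def by (intro reg_inc_beta_poly) auto
  show "M_coeff0 lam p = (poly G 1 - poly G (exp (- lam))) / lam"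
    unfolding M_coeff0_def x_def [symmetric] I using p by simp
  \<comment> \<open>For \<open>p > 1\<close> the power of \<open>1 - z\<close> vanishes at 1; for
    \<open>p = 1\<close> the linear factor is \<open>3 - 3 z\<close>.\<close>
  have T1: "poly T 1 = 0"
  proof (cases "p = 1")
    case False
    with p have "0 < p - 1" by simp
    then show ?thesis by (simp add: T_def poly_power zero_power)
  qed (simp add: T_def)
  have Tx: "poly T x = exp (- (real p * lam)) * (1 - x) ^ (p - 1) * (2 + real p - (2 * real p + 1) * x)"
    by (simp add: T_def poly_power x_def exp_of_nat_mult [symmetric] algebra_simps)
  have K: "fact (2 * p - 1) / (fact p * fact (p - 1)) = C / 2"
  proof -
    obtain r where r: "p = Suc r" using p by (cases p) auto
    have f: "(fact p :: real) = real p * fact (p - 1)" "(fact (2 * p) :: real) = 2 * real p * fact (2 * p - 1)"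
      by (simp_all add: r)
    have "C = fact (2 * p) / (fact p * fact p)"
      by (simp add: C_def binomial_fact)
    then show ?thesis
      using p by (simp only: f) (simp add: divide_simps)
  qed
  have Tx': "C / 2 * exp (- (real p * lam)) * (1 - x) ^ (p - 1) * (2 + real p - (2 * real p + 1) * x) =
      C / 2 * poly T x"
    unfolding Tx by (simp only: mult.assoc)
  show "M_coeff1 lam p = lam * (poly G2 1 - poly G2 (exp (- lam)))
      - lam / 24 * (poly (euler_op (euler_op G)) 1 - poly (euler_op (euler_op G)) (exp (- lam)))"
    unfolding M_coeff1_def x_def [symmetric] I K Tx' G2_def
    by (simp add: T1 field_simps power2_eq_square)
qed

theorem theorem2p3:
  fixes lam :: real and p :: nat
  assumes "lam > 0" and "p \<ge> 1"
  shows "(\<forall>N\<ge>1. q_scaled lam N ^ p * qGUE_moment (q_scaled lam N) N p =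
            (q_scaled lam N * (1 - q_scaled lam N)) ^ p * qGUE_moment_hat (q_scaled lam N) N p) \<and>
         (\<lambda>N. q_scaled lam N ^ p * qGUE_moment (q_scaled lam N) N p -
              (M_coeff0 lam p * real N + M_coeff1 lam p / real N))
           \<in> O[sequentially](\<lambda>N. 1 / real N ^ 3)"
proof
  have q: "0 < q_scaled lam N" "q_scaled lam N < 1" if "N \<ge> 1" for N
    using that assms by (auto simp: q_scaled_def)
  show "\<forall>N\<ge>1. q_scaled lam N ^ p * qGUE_moment (q_scaled lam N) N p =
      (q_scaled lam N * (1 - q_scaled lam N)) ^ p * qGUE_moment_hat (q_scaled lam N) N p"
    using q by (force simp: qGUE_moment_hat_def power_mult_distrib)
  define C where "C = real ((2 * p) choose p)"
  obtain G where G: "pderiv G = smult C ([:0, 1:] ^ (p - 1) * [:1, - 1:] ^ p)"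
    by (rule poly_antiderivative)
  define T where "T = [:0, 1:] ^ p * [:1, - 1:] ^ (p - 1) * [:2 + real p, - (2 * real p + 1):]"
  define G2 where "G2 = smult (1 / 24) (euler_op (euler_op G)) - smult (real p ^ 2 / 6) G + smult (real p * C / 12) T"
  define z where "z = (\<lambda>N j. exp (- (real j + 1 / 2) * (lam / real N)))"
  define D where "D = (\<lambda>P. poly P 1 - poly P (exp (- lam)) :: real)"
  obtain K where K: "\<And>h z. \<bar>h\<bar> \<le> 1 \<Longrightarrow> 0 \<le> z \<Longrightarrow> z \<le> 1 \<Longrightarrow>
      \<bar>path_sum (edge_weight h z) p p - (path_coeff0 p p z + path_coeff2 p p z * h ^ 2)\<bar> \<le> K * h ^ 4"
    using path_sum_edge_weight_expansion[of p] by blast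
  have moment: "q_scaled lam N ^ p * qGUE_moment (q_scaled lam N) N p =
      (\<Sum>j<N. path_sum (edge_weight (lam / N) (z N j)) p p)" if "N \<ge> 1" for N
  proof (rule qGUE_moment_path_sum[OF q[OF that]])
    fix j n :: nat and s :: int
    assume *: "int n = int j + s"
    \<comment> \<open>The half-steps cancel: \<open>(j + 1/2) + (s - 1/2) = n\<close>.\<close>
    have "z N j * exp (- (lam / real N) * (of_int s - 1 / 2)) = q_scaled lam N ^ n"
      unfolding z_def q_scaled_def exp_add [symmetric] exp_of_nat_mult [symmetric]
      using arg_cong[OF *, of real_of_int] by (simp add: algebra_simps add_divide_distrib)
    then show "edge_weight (lam / real N) (z N j) s = q_scaled lam N ^ n * (1 - q_scaled lam N ^ n)"
      by (simp only: edge_weight_def)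
  qed
  define S where "S = (\<lambda>P N. \<Sum>j<N. poly (euler_op P) (z N j))"
  \<comment> \<open>\<open>R\<close> is the error of the midpoint rule; \<open>Er\<close> below is
    the error of expanding the path sums in \<open>h = lam / N\<close>.\<close>
  define R where "R = (\<lambda>P N. S P N - (D P * (real N / lam) - lam / (24 * real N) * D (euler_op (euler_op P))))"
  have R: "R P \<in> O(\<lambda>N. 1 / real N ^ 3)" for P
    using midpoint_sum_poly[OF assms(1), of P] by (simp add: R_def S_def z_def D_def)
  define Er where "Er = (\<lambda>N. (\<Sum>j<N. path_sum (edge_weight (lam / N) (z N j)) p p) -
      (S G N + (lam / real N) ^ 2 * S G2 N))"
  \<comment> \<open>The bound \<open>N \<ge> lam\<close> gives \<open>h \<le> 1\<close>; the
    \<open>N\<close> summands of size at most \<open>K * h^4\<close> add up to order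
    \<open>1 / N^3\<close>.\<close>
  have "\<bar>Er N\<bar> \<le> K * lam ^ 4 * (1 / real N ^ 3)" if "N \<ge> 1" "real N \<ge> lam" for N
  proof -
    have "Er N = (\<Sum>j<N. path_sum (edge_weight (lam / N) (z N j)) p p -
        (path_coeff0 p p (z N j) + path_coeff2 p p (z N j) * (lam / N) ^ 2))"
      unfolding Er_def S_def
      using path_coeff2_poly[OF assms(2) G[unfolded C_def]]
      by (simp add: sum_subtractf sum.distrib sum_distrib_left C_def G2_def T_def mult_ac)
    also have "\<bar>\<dots>\<bar> \<le> (\<Sum>j<N. K * (lam / N) ^ 4)"
    proof (intro order.trans[OF sum_abs] sum_mono K)
      show "\<bar>lam / real N\<bar> \<le> 1" using that assms by simp
      show "0 \<le> z N j" for j by (simp add: z_def)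
      show "z N j \<le> 1" for j
        unfolding z_def exp_le_one_iff using assms by (intro mult_nonpos_nonneg) auto
    qed
    also have "\<dots> = K * lam ^ 4 * (1 / real N ^ 3)"
      using that by (simp add: power_divide numeral_eq_Suc)
    finally show ?thesis .
  qed
  then have Er: "Er \<in> O(\<lambda>N. 1 / real N ^ 3)"
    using eventually_ge_at_top[of "nat \<lceil>lam\<rceil>"]
    by (intro bigoI[of _ "K * lam ^ 4"])
      (auto elim!: eventually_elim2[OF eventually_ge_at_top[of 1]] simp: nat_ceiling_le_eq)
  have h2: "(\<lambda>N. (lam / real N) ^ 2) \<in> O(\<lambda>N. 1)"
    using assms(1) by real_asymp
  have "(\<lambda>N. (lam / real N) ^ 2 * R G2 N) \<in> O(\<lambda>N. 1 / real N ^ 3)"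
    using landau_o.big.mult[OF h2 R[of G2]] by simp
  \<comment> \<open>The midpoint correction for \<open>G2\<close> carries an extra
    \<open>h^2\<close> and so belongs to the error.\<close>
  moreover have "(\<lambda>N. lam ^ 3 / 24 * D (euler_op (euler_op G2)) * (1 / real N ^ 3)) \<in> O(\<lambda>N. 1 / real N ^ 3)"
    by (rule bigoI[of _ "\<bar>lam ^ 3 / 24 * D (euler_op (euler_op G2))\<bar>"]) (simp add: abs_mult)
  ultimately have "(\<lambda>N. Er N + R G N + ((lam / real N) ^ 2 * R G2 N -
      lam ^ 3 / 24 * D (euler_op (euler_op G2)) * (1 / real N ^ 3))) \<in> O(\<lambda>N. 1 / real N ^ 3)"
    by (intro sum_in_bigo Er R)
  \<comment> \<open>Apart from errors, the order \<open>N\<close> comes from \<open>G\<close>, and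
    the order \<open>1 / N\<close> from \<open>h^2\<close> times the main term of \<open>G2\<close>
    and the midpoint correction for \<open>G\<close>.\<close>
  moreover have "\<forall>\<^sub>F N in sequentially.
      Er N + R G N + ((lam / real N) ^ 2 * R G2 N -
        lam ^ 3 / 24 * D (euler_op (euler_op G2)) * (1 / real N ^ 3)) =
      q_scaled lam N ^ p * qGUE_moment (q_scaled lam N) N p -
        (M_coeff0 lam p * real N + M_coeff1 lam p / real N)"
    using eventually_ge_at_top[of 1]
  proof eventually_elim
    case (elim N)
    have M: "M_coeff0 lam p = D G / lam" "M_coeff1 lam p = lam * D G2 - lam / 24 * D (euler_op (euler_op G))"
      using M_coeff_poly[OF assms G[unfolded C_def]] by (simp_all add: D_def G2_def T_def C_def)
    have 2: "(lam / real N) ^ 2 * (lam / (24 * real N) * D (euler_op (euler_op G2))) =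
        lam ^ 3 / 24 * D (euler_op (euler_op G2)) * (1 / real N ^ 3)"
      by (simp add: power_divide power2_eq_square power3_eq_cube)
    have 3: "(lam / real N) ^ 2 * (D G2 * (real N / lam)) = lam * D G2 / real N"
      using elim assms by (simp add: power2_eq_square)
    show ?case
      unfolding moment[OF elim] M Er_def R_def 2[symmetric]
      using 3 by (simp add: algebra_simps diff_divide_distrib)
  qed
  ultimately show "(\<lambda>N. q_scaled lam N ^ p * qGUE_moment (q_scaled lam N) N p -
      (M_coeff0 lam p * real N + M_coeff1 lam p / real N)) \<in> O(\<lambda>N. 1 / real N ^ 3)"
    by (rule landau_o.big.in_cong[THEN iffD1, rotated])
qed

end
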